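(* Let $(\Omega,\mu)$ and $(\Delta,\nu)$ be finite measure spaces and let $\mathcal{H}$, $\mathcal{H}_0$ be Hilbert spaces. Let $\{A_\alpha\}_{\alpha\in\Omega}$ and $\{B_\beta\}_{\beta\in\Delta}$ be continuous operator-valued Parseval frames in $\mathcal{B}(\mathcal{H},\mathcal{H}_0)$. Then $$\log\big(\mu(\Omega)\nu(\Delta)\big)\ \geq\ S_A(h)+S_B(h)\ \geq\ -2\log\left(\sup_{\alpha\in\Omega,\ \beta\in\Delta}\|B_\beta A_\alpha^*\|\right),\qquad \forall h\in\mathcal{H}_A\cap\mathcal{H}_B.$$
   Context: Hilbert spaces are over $\mathbb{K}=\mathbb{R}$ or $\mathbb{C}$ and need not be finite dimensional. $\mathcal{B}(\mathcal{H},\mathcal{H}_0)$ denotes the set of all continuous linear operators from $\mathcal{H}$ to $\mathcal{H}_0$; $A^*$ is the Hilbert-space adjoint and $\|B_\beta A_\alpha^*\|$ is the operator norm on $\mathcal{B}(\mathcal{H}_0,\mathcal{H}_0)$. Given a measure space $(\Omega,\mu)$, a family $\{A_\alpha\}_{\alpha\in\Omega}$ in $\mathcal{B}(\mathcal{H},\mathcal{H}_0)$ is a continuous operator-valued Parseval frame in $\mathcal{B}(\mathcal{H},\mathcal{H}_0)$ if (i) for each $h\in\mathcal{H}$ the map $\Omega\ni\alpha\mapsto A_\alpha h\in\mathcal{H}_0$ is weakly measurable, and (ii) $\|h\|^2=\int_\Omega\|A_\alpha h\|^2\,d\mu(\alpha)$ for all $h\in\mathcal{H}$. For such a frame, $\mathcal{H}_A:=\{h\in\mathcal{H}:\|h\|=1,\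 A_\alpha h\neq 0\ \ \forall\alpha\in\Omega\}$, and the continuous Shannon entropy of $\{A_\alpha\}_{\alpha\in\Omega}$ at $h\in\mathcal{H}_A$ is $$S_A(h):=-\int_\Omega\|A_\alpha h\|^2\log\|A_\alpha h\|^2\,d\mu(\alpha).$$ $\mathcal{H}_B$ and $S_B(h)$ are defined in the same way from $\{B_\beta\}_{\beta\in\Delta}$ and $(\Delta,\nu)$. *)

theory Defs
  imports "HOL-Analysis.Analysis"
begin

text \<open>
  Real Hilbert spaces are the types of sort \<open>{real_inner, complete_space}\<close>; complex Hilbert
  spaces are the types of sort \<open>{complex_inner, complete_space}\<close>, for the class below.  Every
  complex inner product space is canonically a real one, with real inner product
  \<open>Re (cinner x y)\<close>; this is how it receives its norm, metric and topology from
  \<^class>\<open>real_inner\<close>.  The inner product is linear in its first argument.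
\<close>

class complex_inner = real_inner +
  fixes scaleC :: "complex \<Rightarrow> 'a \<Rightarrow> 'a"  (infixr \<open>*\<^sub>C\<close> 75)
    and cinner :: "'a \<Rightarrow> 'a \<Rightarrow> complex"
  assumes scaleC_add_right: "c *\<^sub>C (x + y) = c *\<^sub>C x + c *\<^sub>C y"
    and scaleC_add_left: "(c + d) *\<^sub>C x = c *\<^sub>C x + d *\<^sub>C x"
    and scaleC_scaleC: "c *\<^sub>C d *\<^sub>C x = (c * d) *\<^sub>C x"
    and scaleC_of_real: "complex_of_real r *\<^sub>C x = scaleR r x"
    and cinner_commute: "cinner y x = cnj (cinner x y)"
    and cinner_add_left: "cinner (x + y) z = cinner x z + cinner y z"
    and cinner_scaleC_left: "cinner (c *\<^sub>C x) y = c * cinner x y"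
    and Re_cinner: "Re (cinner x y) = inner x y"

lemma cinner_self: "cinner x x = complex_of_real ((norm x)\<^sup>2)"
proof (rule complex_eqI)
  show "Re (cinner x x) = Re (complex_of_real ((norm x)\<^sup>2))"
    by (simp add: Re_cinner power2_norm_eq_inner)
  have "Im (cinner x x) = - Im (cinner x x)"
    using arg_cong[OF cinner_commute[of x x], of Im] by simp
  then show "Im (cinner x x) = Im (complex_of_real ((norm x)\<^sup>2))"
    by simp
qed

instantiation complex :: complex_inner
begin

definition scaleC_complex_def: "scaleC c (x :: complex) = c * x"
definition cinner_complex_def: "cinner x y = x * cnj (y :: complex)"

instance
  by standard
    (simp_all add: scaleC_complex_def cinner_complex_def inner_complex_def scaleR_conv_of_real
      algebra_simps)

end

text \<open>Continuous complex-linear operators, and their adjoints (\<^const>\<open>adjoint\<close> is the real counterpart).\<close>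

definition bounded_clinear :: "('a::complex_inner \<Rightarrow> 'b::complex_inner) \<Rightarrow> bool" where
  "bounded_clinear f \<longleftrightarrow> bounded_linear f \<and> (\<forall>c x. f (c *\<^sub>C x) = c *\<^sub>C f x)"

definition cadjoint :: "('a::complex_inner \<Rightarrow> 'b::complex_inner) \<Rightarrow> 'b \<Rightarrow> 'a" where
  "cadjoint f = (SOME g. \<forall>x y. cinner (f x) y = cinner x (g y))"

text \<open>
  The Parseval identity is stated with \<^const>\<open>has_bochner_integral\<close>, so it includes the
  measurability of \<open>\<alpha> \<mapsto> \<parallel>A\<^sub>\<alpha> h\<parallel>\<^sup>2\<close>, which
  weak measurability does not give when the codomain is not separable.
\<close>

definition parseval_frame ::
    "'o measure \<Rightarrow> ('o \<Rightarrow> 'a::real_inner \<Rightarrow> 'b::real_inner) \<Rightarrow> bool" where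
  "parseval_frame M A \<longleftrightarrow>
     (\<forall>\<alpha>\<in>space M. bounded_linear (A \<alpha>)) \<and>
     (\<forall>h k. (\<lambda>\<alpha>. inner (A \<alpha> h) k) \<in> borel_measurable M) \<and>
     (\<forall>h. has_bochner_integral M (\<lambda>\<alpha>. (norm (A \<alpha> h))\<^sup>2) ((norm h)\<^sup>2))"

definition cparseval_frame ::
    "'o measure \<Rightarrow> ('o \<Rightarrow> 'a::complex_inner \<Rightarrow> 'b::complex_inner) \<Rightarrow> bool" where
  "cparseval_frame M A \<longleftrightarrow>
     (\<forall>\<alpha>\<in>space M. bounded_clinear (A \<alpha>)) \<and>
     (\<forall>h k. (\<lambda>\<alpha>. cinner (A \<alpha> h) k) \<in> borel_measurable M) \<and>
     (\<forall>h. has_bochner_integral M (\<lambda>\<alpha>. (norm (A \<alpha> h))\<^sup>2) ((norm h)\<^sup>2))"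

definition entropy_domain ::
    "'o measure \<Rightarrow> ('o \<Rightarrow> 'a::real_normed_vector \<Rightarrow> 'b::real_normed_vector) \<Rightarrow> 'a set" where
  "entropy_domain M A = {h. norm h = 1 \<and> (\<forall>\<alpha>\<in>space M. A \<alpha> h \<noteq> 0)}"

text \<open>
  The integral of the entropy need not converge: on a finite measure space the negative part of
  \<open>t * ln t\<close> is bounded, but the positive part may have infinite integral, and the entropy is
  then \<open>-\<infinity>\<close>.  The Bochner integral would return the meaningless value 0 there, so the
  integral is taken in the extended reals.  (The case \<open>\<infinity> - \<infinity>\<close> cannot occur on a finite
  measure space.)
\<close>

definition extended_integral :: "'o measure \<Rightarrow> ('o \<Rightarrow> real) \<Rightarrow> ereal" where
  "extended_integral M f =
     enn2ereal (\<integral>\<^sup>+x. ennreal (f x) \<partial>M) - enn2ereal (\<integral>\<^sup>+x. ennreal (- f x) \<partial>M)"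

lemma extended_integral_eq_integral:
  assumes "integrable M f"
  shows "extended_integral M f = ereal (integral\<^sup>L M f)"
proof -
  have fin: "(\<integral>\<^sup>+x. ennreal (f x) \<partial>M) < \<infinity>" "(\<integral>\<^sup>+x. ennreal (- f x) \<partial>M) < \<infinity>"
    using assms by (auto simp: real_integrable_def less_top)
  then obtain a b where ab: "0 \<le> a" "(\<integral>\<^sup>+x. ennreal (f x) \<partial>M) = ennreal a"
      "0 \<le> b" "(\<integral>\<^sup>+x. ennreal (- f x) \<partial>M) = ennreal b"
    by (metis ennreal_cases infinity_ennreal_def less_irrefl)
  then show ?thesis
    by (simp add: extended_integral_def real_lebesgue_integral_def[OF assms] enn2ereal_ennreal)
qed

definition shannon_entropy ::
    "'o measure \<Rightarrow> ('o \<Rightarrow> 'a::real_normed_vector \<Rightarrow> 'b::real_normed_vector) \<Rightarrow> 'a \<Rightarrow> ereal" where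
  "shannon_entropy M A h =
     - extended_integral M (\<lambda>\<alpha>. (norm (A \<alpha> h))\<^sup>2 * ln ((norm (A \<alpha> h))\<^sup>2))"

definition ereal_ln :: "ereal \<Rightarrow> ereal" where
  "ereal_ln x = (if x \<le> 0 then - \<infinity> else if x = \<infinity> then \<infinity> else ereal (ln (real_of_ereal x)))"

end

theory Submission
  imports Defs "HOL-Complex_Analysis.Conformal_Mappings"
begin

text \<open>
  The upper bound is Jensen's inequality: \<open>\<parallel>A\<^sub>\<alpha> h\<parallel>\<^sup>2\<close> is a probability density, and no density
  on a space of total mass \<open>\<mu>\<close> has entropy above \<open>ln \<mu>\<close> (\<open>shannon_entropy_le\<close>).

  The lower bound is of Maassen-Uffink type.  Let \<open>C\<close> be the supremum of the operator norms of
  \<open>B\<^sub>\<beta> A\<^sub>\<alpha>\<^sup>*\<close>, and write \<open>f = \<parallel>A\<^sub>\<alpha> h\<parallel>\<close> and \<open>g = \<parallel>B\<^sub>\<beta> h\<parallel>\<close>.  Composing synthesis by \<open>A\<close> with analysis by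
  \<open>B\<close> gives an operator that is an \<open>L\<^sup>2\<close> contraction and whose kernel \<open>B\<^sub>\<beta> A\<^sub>\<alpha>\<^sup>*\<close> is bounded by \<open>C\<close>;
  it sends the coefficients \<open>A\<^sub>\<alpha> h\<close> to \<open>B\<^sub>\<beta> h\<close>.  Interpolation between the two bounds, differentiated
  at the \<open>L\<^sup>2\<close> end, where equality holds, compares entropies.

  The interpolation is carried out with simple weights only.  For simple functions \<open>l\<close> and \<open>r\<close> the
  pairing of \<open>exp (z * l)\<close> times the coefficients of \<open>h\<close> under \<open>A\<close> with \<open>exp (z * r)\<close> times those
  under \<open>B\<close> is a finite exponential sum in \<open>z\<close>.  It is 1 at 0, at most 1 in modulus on the
  imaginary axis, and bounded by the kernel estimate on \<open>Re z = 1\<close>.  The three lines theorem, read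
  off at the derivative in 0, yields (\<open>simple_weight_inequality\<close>)

    \<open>exp (\<integral> l f\<^sup>2 + \<integral> r g\<^sup>2) \<le> C * (\<integral> exp l * f) * (\<integral> exp r * g)\<close>.

  Letting \<open>l\<close> and \<open>r\<close> approach \<open>ln f\<close> and \<open>ln g\<close> turns the last two integrals into 1 and gives
  \<open>\<integral> f\<^sup>2 * ln f + \<integral> g\<^sup>2 * ln g \<le> ln C\<close> (\<open>log_inequality\<close>); multiplied by \<open>- 2\<close>, this is the claim.

  Everything is done over the reals.  A complex Hilbert space is a real one under the real part of
  its inner product, with the same operator norms and adjoints (\<open>cadjoint_eq_adjoint\<close>).
\<close>

section \<open>Riesz representation and Hilbert-space adjoints\<close>

text \<open>
  The minimiser of this quadratic functional is the Riesz vector of \<open>\<phi>\<close>.  A minimising sequence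
  is Cauchy by the parallelogram law, so completeness replaces the compactness that gives a
  minimiser in finite dimension.
\<close>

lemma hilbert_minimizing_vector:
  fixes \<phi> :: "'a::{real_inner, complete_space} \<Rightarrow> real"
  assumes \<phi>: "bounded_linear \<phi>"
  obtains v where "\<And>x. (norm v)\<^sup>2 - 2 * \<phi> v \<le> (norm x)\<^sup>2 - 2 * \<phi> x"
proof -
  interpret bounded_linear \<phi> by (rule \<phi>)
  define J where "J x = (norm x)\<^sup>2 - 2 * \<phi> x" for x
  obtain K where K: "\<And>x. norm (\<phi> x) \<le> norm x * K"
    using bounded by blast
  have lower: "- (K\<^sup>2) \<le> J x" for x
  proof -
    have "\<phi> x \<le> norm x * K" using K[of x] by simp
    moreover have "0 \<le> (norm x - K)\<^sup>2" by simp
    ultimately show ?thesis by (simp add: J_def power2_diff)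
  qed
  define m where "m = (INF x. J x)"
  have bdd: "bdd_below (range J)" using lower by (auto intro!: bdd_belowI[of _ "- (K\<^sup>2)"])
  have m_le: "m \<le> J x" for x unfolding m_def by (rule cINF_lower[OF bdd]) simp
  have "\<exists>x. J x < m + 1 / real (Suc n)" for n
  proof -
    have "(INF x. J x) < m + 1 / real (Suc n)" unfolding m_def by simp
    then show ?thesis by (subst (asm) cINF_less_iff) (use bdd in auto)
  qed
  then obtain X where X: "\<And>n. J (X n) < m + 1 / real (Suc n)" by metis
  (* The parallelogram law, with the midpoint competing for the infimum. *)
  have close: "(norm (x - y))\<^sup>2 \<le> 2 * (J x - m) + 2 * (J y - m)" for x y
  proof -
    have "(norm (x - y))\<^sup>2 = 2 * J x + 2 * J y - 4 * J ((1/2) *\<^sub>R (x + y))"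
      by (simp add: J_def power2_norm_eq_inner add scaleR inner_diff_left inner_diff_right
          inner_add_left inner_add_right inner_commute algebra_simps)
    then show ?thesis using m_le[of "(1/2) *\<^sub>R (x + y)"] by simp
  qed
  have "Cauchy X"
  proof (rule metric_CauchyI)
    fix e :: real assume "0 < e"
    then obtain k where k: "1 / real (Suc k) < e\<^sup>2 / 4"
      using nat_approx_posE[of "e\<^sup>2 / 4"] by auto
    have "dist (X i) (X j) < e" if "k \<le> i" "k \<le> j" for i j
    proof -
      have "J (X n) < m + e\<^sup>2 / 4" if "k \<le> n" for n
      proof -
        have "1 / real (Suc n) \<le> 1 / real (Suc k)" using that by (simp add: frac_le)
        from add_strict_left_mono[OF le_less_trans[OF this k], of m] show ?thesis
          by (rule less_trans[OF X])
      qed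
      from this[OF that(1)] this[OF that(2)] have "(norm (X i - X j))\<^sup>2 < e\<^sup>2"
        using close[of "X i" "X j"] by (simp add: field_simps)
      then show ?thesis using \<open>0 < e\<close> by (simp add: dist_norm power_less_imp_less_base)
    qed
    then show "\<exists>k. \<forall>i\<ge>k. \<forall>j\<ge>k. dist (X i) (X j) < e" by blast
  qed
  then obtain v where v: "X \<longlonglongrightarrow> v" using Cauchy_convergent convergentD by blast
  have "(\<lambda>n. J (X n)) \<longlonglongrightarrow> J v"
    unfolding J_def by (intro tendsto_intros tendsto v)
  moreover have "(\<lambda>n. m + 1 / real (Suc n)) \<longlonglongrightarrow> m + 0"
    by (intro tendsto_intros LIMSEQ_inverse_real_of_nat[unfolded inverse_eq_divide])
  ultimately have "J v \<le> m"
    using X by (intro LIMSEQ_le[of "\<lambda>n. J (X n)"]) (auto intro: less_imp_le)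
  then show thesis using that[of v] m_le unfolding J_def by (meson order_trans)
qed

text \<open>
  At a minimiser \<open>v\<close> of \<open>(norm x)\<^sup>2 - 2 * \<phi> x\<close> the derivative in every direction \<open>x\<close>, which
  is \<open>2 * (inner x v - \<phi> x)\<close>, has to vanish.
\<close>

theorem riesz_representation:
  fixes \<phi> :: "'a::{real_inner, complete_space} \<Rightarrow> real"
  assumes \<phi>: "bounded_linear \<phi>"
  obtains v where "\<And>x. \<phi> x = inner x v"
proof -
  interpret bounded_linear \<phi> by (rule \<phi>)
  obtain v where v: "\<And>x. (norm v)\<^sup>2 - 2 * \<phi> v \<le> (norm x)\<^sup>2 - 2 * \<phi> x"
    using hilbert_minimizing_vector[OF \<phi>] by blast
  have "\<phi> x = inner x v" for x
  proof -
    define d where "d = inner x v - \<phi> x"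
    (* A multiple of d that makes the first-order term outweigh the second-order one. *)
    define t where "t = - d / ((norm x)\<^sup>2 + 1)"
    have pos: "0 < (norm x)\<^sup>2 + 1" by (simp add: add_nonneg_pos)
    have "(norm (v + t *\<^sub>R x))\<^sup>2 = (norm v)\<^sup>2 + 2 * t * inner x v + t\<^sup>2 * (norm x)\<^sup>2"
      unfolding power2_norm_eq_inner
      by (simp add: inner_add_left inner_add_right inner_commute[of v x] power2_eq_square
          algebra_simps)
    then have "0 \<le> 2 * t * d + t\<^sup>2 * (norm x)\<^sup>2"
      using v[of "v + t *\<^sub>R x"] by (simp add: d_def add scaleR algebra_simps)
    also have "\<dots> \<le> 2 * t * d + t\<^sup>2 * ((norm x)\<^sup>2 + 1)" by (simp add: mult_left_mono)
    also have "\<dots> = - (d\<^sup>2 / ((norm x)\<^sup>2 + 1))"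
      using pos by (simp add: t_def power2_eq_square divide_simps)
    finally have "d\<^sup>2 / ((norm x)\<^sup>2 + 1) \<le> 0" by simp
    then have "d = 0" using pos by (simp add: divide_le_0_iff)
    then show ?thesis by (simp add: d_def)
  qed
  then show thesis using that by blast
qed

text \<open>
  Riesz representation makes the arbitrary choice in the definition of \<^const>\<open>adjoint\<close> a genuine
  adjoint in any Hilbert space.
\<close>

lemma inner_adjoint:
  fixes f :: "'a::{real_inner, complete_space} \<Rightarrow> 'b::real_inner"
  assumes f: "bounded_linear f"
  shows "inner (f x) y = inner x (adjoint f y)"
proof -
  have "\<exists>v. \<forall>x. inner (f x) y = inner x v" for y
    using riesz_representation[OF bounded_linear_compose[OF bounded_linear_inner_left f, of y]]
    by metis
  then have "\<exists>g. \<forall>x y. inner (f x) y = inner x (g y)" by metis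
  then show ?thesis unfolding adjoint_def by (rule someI2_ex) blast
qed

text \<open>
  The bound comes from \<open>\<parallel>A\<^sup>* x\<parallel>\<^sup>2 = \<langle>A A\<^sup>* x, x\<rangle>\<close> and the Cauchy-Schwarz inequality.
\<close>

lemma bounded_linear_adjoint:
  fixes f :: "'a::{real_inner, complete_space} \<Rightarrow> 'b::real_inner"
  assumes f: "bounded_linear f"
  shows "bounded_linear (adjoint f)"
proof -
  note adj = inner_adjoint[OF f]
  have eqI: "u = v" if "\<And>x. inner x u = inner x v" for u v :: 'a
    using that[of "u - v"] by (metis inner_diff_right inner_eq_zero_iff right_minus_eq)
  obtain K where K: "\<And>x. norm (f x) \<le> norm x * K"
    using bounded_linear.bounded[OF f] by blast
  show ?thesis
  proof (rule bounded_linear_intro)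
    fix x y r
    show "adjoint f (x + y) = adjoint f x + adjoint f y"
      by (rule eqI) (simp add: adj[symmetric] inner_add_right)
    show "adjoint f (r *\<^sub>R x) = r *\<^sub>R adjoint f x"
      by (rule eqI) (simp add: adj[symmetric])
    have "norm (adjoint f x) * norm (adjoint f x) = inner (f (adjoint f x)) x"
      by (simp add: adj power2_norm_eq_inner[symmetric] power2_eq_square[symmetric])
    also have "\<dots> \<le> norm (f (adjoint f x)) * norm x" by (rule norm_cauchy_schwarz)
    also have "\<dots> \<le> norm (adjoint f x) * K * norm x" by (intro mult_right_mono K) simp
    finally have *: "norm (adjoint f x) * norm (adjoint f x) \<le> norm (adjoint f x) * (norm x * K)"
      by (simp add: ac_simps)
    show "norm (adjoint f x) \<le> norm x * \<bar>K\<bar>"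
    proof (cases "adjoint f x = 0")
      case False
      then have "norm (adjoint f x) \<le> norm x * K" using * by simp
      also have "\<dots> \<le> norm x * \<bar>K\<bar>" by (simp add: mult_left_mono)
      finally show ?thesis .
    qed simp
  qed
qed

text \<open>
  The complex inner product is determined by its real part, so for a complex-linear operator the
  real adjoint is also a complex one.  This carries the complex theorem back to the real one.
\<close>

lemma cadjoint_eq_adjoint:
  fixes f :: "'a::{complex_inner, complete_space} \<Rightarrow> 'b::complex_inner"
  assumes f: "bounded_clinear f"
  shows "cadjoint f = adjoint f"
proof -
  have bl: "bounded_linear f" and fC: "\<And>c x. f (c *\<^sub>C x) = c *\<^sub>C f x"
    using f by (auto simp: bounded_clinear_def)
  (* The imaginary part of the inner product is the real inner product with a vector rotated by -i. *)
  have Im_cinner: "Im (cinner x y) = inner ((- \<i>) *\<^sub>C x) y" for x y :: "'c::complex_inner"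
    by (simp add: Re_cinner[symmetric] cinner_scaleC_left)
  have "\<exists>g. \<forall>x y. cinner (f x) y = cinner x (g y)"
    by (rule exI[of _ "adjoint f"])
      (auto intro!: complex_eqI simp: Re_cinner Im_cinner fC[symmetric] inner_adjoint[OF bl])
  from someI_ex[OF this] have "\<forall>x y. cinner (f x) y = cinner x (cadjoint f y)"
    unfolding cadjoint_def .
  then have "\<forall>x y. inner (f x) y = inner x (cadjoint f y)"
    by (simp add: Re_cinner[symmetric])
  then show ?thesis by (rule adjoint_unique[symmetric])
qed

lemma cparseval_frame_imp_parseval_frame:
  assumes "cparseval_frame M A"
  shows "parseval_frame M A"
proof -
  have "(\<lambda>\<alpha>. inner (A \<alpha> h) k) \<in> borel_measurable M" for h k
  proof -
    have [measurable]: "(\<lambda>\<alpha>. cinner (A \<alpha> h) k) \<in> borel_measurable M"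
      using assms by (auto simp: cparseval_frame_def)
    have "(\<lambda>\<alpha>. Re (cinner (A \<alpha> h) k)) \<in> borel_measurable M" by measurable
    then show ?thesis by (simp add: Re_cinner)
  qed
  then show ?thesis
    using assms by (auto simp: cparseval_frame_def parseval_frame_def bounded_clinear_def)
qed

section \<open>The three lines theorem\<close>

text \<open>
  The Phragmen-Lindelof argument: a Gaussian factor makes the function small on the far horizontal
  sides of a rectangle, the maximum modulus principle applies there, and the factor is then
  removed by letting its strength tend to 0.
\<close>

lemma three_lines_unit_bound:
  assumes holo: "G holomorphic_on UNIV"
    and bdd: "\<And>z. 0 \<le> Re z \<Longrightarrow> Re z \<le> 1 \<Longrightarrow> norm (G z) \<le> K"
    and left: "\<And>y. norm (G (Complex 0 y)) \<le> 1"
    and right: "\<And>y. norm (G (Complex 1 y)) \<le> 1"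
    and z: "0 \<le> Re z" "Re z \<le> 1"
  shows "norm (G z) \<le> 1"
proof -
  have K0: "0 \<le> K" using bdd[of 0] norm_ge_zero[of "G 0"] by (simp del: norm_ge_zero)
  (* Gaussian damping, normalised to be at most 1 in the whole strip. *)
  have damped: "norm (G z * exp (of_real e * (z\<^sup>2 - 1))) \<le> 1" if e: "0 < e" for e :: real
  proof -
    define H where "H w = G w * exp (of_real e * (w\<^sup>2 - 1))" for w
    (* The height at which the damping exp (- e * R) has beaten the bound K. *)
    define R where "R = \<bar>Im z\<bar> + 1 + K / e"
    have R: "\<bar>Im z\<bar> < R" "K \<le> e * R" "1 \<le> R"
      using e divide_nonneg_pos[OF K0 e] by (simp_all add: R_def distrib_left)
    have nH: "norm (H w) = norm (G w) * exp (e * ((Re w)\<^sup>2 - (Im w)\<^sup>2 - 1))" for w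
      by (simp add: H_def norm_mult power2_eq_square)
    let ?S = "cbox (Complex 0 (- R)) (Complex 1 R)"
    have "norm (H z) \<le> 1"
    proof (rule maximum_modulus_frontier[of H ?S])
      have hol: "H holomorphic_on UNIV" unfolding H_def by (intro holomorphic_intros holo)
      then show "H holomorphic_on interior ?S" by (rule holomorphic_on_subset) simp
      show "continuous_on (closure ?S) H"
        using holomorphic_on_imp_continuous_on[OF hol] by (rule continuous_on_subset) simp
      show "z \<in> ?S" using z R by (auto simp: in_cbox_complex_iff)
      fix w assume "w \<in> frontier ?S"
      then have w: "w \<in> ?S" "w \<notin> box (Complex 0 (- R)) (Complex 1 R)"
        by (auto simp: frontier_cbox)
      then have Re01: "0 \<le> Re w" "Re w \<le> 1" by (auto simp: in_cbox_complex_iff)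
      then have Re2: "(Re w)\<^sup>2 \<le> 1" by (simp add: power_le_one)
      have side: "norm (H w) \<le> 1" if "norm (G w) \<le> 1"
      proof -
        have "(Re w)\<^sup>2 - (Im w)\<^sup>2 - 1 \<le> 0" using Re2 zero_le_power2[of "Im w"] by linarith
        then have "exp (e * ((Re w)\<^sup>2 - (Im w)\<^sup>2 - 1)) \<le> 1"
          using e by (simp add: mult_nonneg_nonpos)
        then show ?thesis unfolding nH using mult_mono[OF that] by fastforce
      qed
      consider "Re w = 0" | "Re w = 1" | "\<bar>Im w\<bar> = R"
        using w unfolding in_cbox_complex_iff in_box_complex_iff
        by (cases "Re w = 0"; cases "Re w = 1"; cases "\<bar>Im w\<bar> = R") (simp_all, linarith)
      then show "norm (H w) \<le> 1"
      proof cases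
        case 3
        have "(Im w)\<^sup>2 = R\<^sup>2" using 3 by (metis power2_abs)
        then have "R \<le> (Im w)\<^sup>2" using R by (simp add: power2_eq_square)
        then have "e * ((Re w)\<^sup>2 - (Im w)\<^sup>2 - 1) \<le> - (e * R)"
          using mult_left_mono[of "(Re w)\<^sup>2 - (Im w)\<^sup>2 - 1" "- R" e] Re2 e by simp
        then have "norm (H w) \<le> K * exp (- (e * R))"
          unfolding nH using bdd[OF Re01] K0 by (intro mult_mono) auto
        also have "\<dots> \<le> K * exp (- K)" using R K0 by (intro mult_left_mono) auto
        also have "K \<le> exp K" using exp_ge_add_one_self[of K] by linarith
        then have "K * exp (- K) \<le> 1" by (simp add: exp_minus divide_simps)
        finally show ?thesis .
      next
        case 1
        then have "norm (G w) \<le> 1" using left[of "Im w"] by (metis complex_surj)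
        then show ?thesis by (rule side)
      next
        case 2
        then have "norm (G w) \<le> 1" using right[of "Im w"] by (metis complex_surj)
        then show ?thesis by (rule side)
      qed
    qed simp_all
    then show ?thesis by (simp add: H_def)
  qed
  have "((\<lambda>e. norm (G z * exp (of_real e * (z\<^sup>2 - 1)))) \<longlongrightarrow>
      norm (G z * exp (of_real 0 * (z\<^sup>2 - 1)))) (at_right 0)"
    by (intro tendsto_intros)
  moreover have "\<forall>\<^sub>F e in at_right 0. norm (G z * exp (of_real e * (z\<^sup>2 - 1))) \<le> 1"
    using eventually_at_right_less[of "0::real"] by (rule eventually_mono) (rule damped)
  ultimately have "norm (G z * exp (of_real 0 * (z\<^sup>2 - 1))) \<le> 1"
    by (rule tendsto_upperbound) simp
  then show ?thesis by simp
qed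

text \<open>
  By the three lines theorem \<open>norm (F x) \<le> C powr x\<close> for \<open>x\<close> in \<open>{0..1}\<close>, with equality at
  \<open>x = 0\<close>.  Comparing the one-sided derivatives at 0 gives \<open>Re D \<le> ln C\<close>.
\<close>

lemma three_lines_derivative_bound:
  assumes holo: "F holomorphic_on UNIV"
    and bdd: "\<And>z. 0 \<le> Re z \<Longrightarrow> Re z \<le> 1 \<Longrightarrow> norm (F z) \<le> K"
    and left: "\<And>y. norm (F (Complex 0 y)) \<le> 1"
    and right: "\<And>y. norm (F (Complex 1 y)) \<le> C"
    and C: "0 < C"
    and F0: "F 0 = 1"
    and F': "(F has_field_derivative D) (at 0)"
  shows "exp (Re D) \<le> C"
proof -
  define G where "G z = F z * exp (- (of_real (ln C) * z))" for z
  have nG: "norm (G z) = norm (F z) * exp (- (ln C * Re z))" for z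
    by (simp add: G_def norm_mult)
  have G_le: "norm (G z) \<le> 1" if z: "0 \<le> Re z" "Re z \<le> 1" for z
  proof (rule three_lines_unit_bound[OF _ _ _ _ z])
    show "G holomorphic_on UNIV" unfolding G_def by (intro holomorphic_intros holo)
    show "norm (G w) \<le> K * exp \<bar>ln C\<bar>" if w: "0 \<le> Re w" "Re w \<le> 1" for w
    proof -
      have "\<bar>ln C * Re w\<bar> \<le> \<bar>ln C\<bar> * 1"
        unfolding abs_mult using w by (intro mult_mono) auto
      then have "exp (- (ln C * Re w)) \<le> exp \<bar>ln C\<bar>" by auto
      moreover have "0 \<le> K" using bdd[OF w] norm_ge_zero order_trans by blast
      ultimately show ?thesis unfolding nG using bdd[OF w] by (intro mult_mono) auto
    qed
    show "norm (G (Complex 0 y)) \<le> 1" for y using left[of y] by (simp add: nG)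
    show "norm (G (Complex 1 y)) \<le> 1" for y
      using right[of y] C by (simp add: nG exp_minus divide_simps)
  qed
  have "(G has_field_derivative (D - of_real (ln C))) (at 0)"
    unfolding G_def using F0 by (auto intro!: derivative_eq_intros F')
  then have "(G has_field_derivative (D - of_real (ln C))) (at (of_real 0))" by simp
  from has_field_derivative_Re[OF has_vector_derivative_real_field[OF this]]
  have "((\<lambda>x. Re (G (of_real x))) has_field_derivative Re (D - of_real (ln C))) (at 0)" .
  (* G has modulus at most 1 on [0,1] and equals 1 at 0, so its real part cannot increase there. *)
  then have "\<not> 0 < Re (D - of_real (ln C))"
  proof (intro notI)
    assume d: "((\<lambda>x. Re (G (of_real x))) has_field_derivative Re (D - of_real (ln C))) (at 0)"
      and "0 < Re (D - of_real (ln C))"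
    then obtain e where "0 < e" and e: "\<And>h. 0 < h \<Longrightarrow> h < e \<Longrightarrow> Re (G (of_real 0)) < Re (G (of_real (0 + h)))"
      using DERIV_pos_inc_right by blast
    define h where "h = min (e / 2) 1"
    have h: "0 < h" "h < e" "h \<le> 1" using \<open>0 < e\<close> by (auto simp: h_def)
    have "Re (G (of_real h)) \<le> 1"
      using complex_Re_le_cmod[of "G (of_real h)"] G_le[of "of_real h"] h by simp
    then show False using e[OF h(1,2)] by (simp add: G_def F0)
  qed
  then have "exp (Re D) \<le> exp (ln C)" by simp
  then show ?thesis using C by simp
qed

section \<open>Parseval frames as weighted resolutions of a vector\<close>

lemma parseval_frame_linear:
  assumes "parseval_frame M A" "\<alpha> \<in> space M"
  shows "bounded_linear (A \<alpha>)"
  using assms by (simp add: parseval_frame_def)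

lemma parseval_frame_norm_sq:
  assumes "parseval_frame M A"
  shows "integrable M (\<lambda>\<alpha>. (norm (A \<alpha> h))\<^sup>2)"
    and "(\<integral>\<alpha>. (norm (A \<alpha> h))\<^sup>2 \<partial>M) = (norm h)\<^sup>2"
  using assms by (auto simp: parseval_frame_def has_bochner_integral_iff)

text \<open>
  Weak measurability alone does not give this when the codomain is not separable; it comes from
  the Parseval identity.
\<close>

lemma parseval_frame_norm_measurable:
  assumes "parseval_frame M A"
  shows "(\<lambda>\<alpha>. norm (A \<alpha> h)) \<in> borel_measurable M"
proof -
  have [measurable]: "(\<lambda>\<alpha>. (norm (A \<alpha> h))\<^sup>2) \<in> borel_measurable M"
    using parseval_frame_norm_sq(1)[OF assms] by simp
  have "(\<lambda>\<alpha>. sqrt ((norm (A \<alpha> h))\<^sup>2)) \<in> borel_measurable M" by measurable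
  then show ?thesis by simp
qed

text \<open>
  Polarisation of the Parseval identity.  It supplies the measurability of the integrand, in which
  both arguments of the inner product vary.
\<close>

lemma parseval_frame_inner:
  assumes A: "parseval_frame M A"
  shows "integrable M (\<lambda>\<alpha>. inner (A \<alpha> h) (A \<alpha> k))"
    and "(\<integral>\<alpha>. inner (A \<alpha> h) (A \<alpha> k) \<partial>M) = inner h k"
proof -
  let ?P = "\<lambda>\<alpha>. ((norm (A \<alpha> (h + k)))\<^sup>2 - (norm (A \<alpha> h))\<^sup>2 - (norm (A \<alpha> k))\<^sup>2) / 2"
  have eq: "inner (A \<alpha> h) (A \<alpha> k) = ?P \<alpha>" if "\<alpha> \<in> space M" for \<alpha>
  proof -
    interpret bounded_linear "A \<alpha>" using parseval_frame_linear[OF A that] .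
    show ?thesis
      by (simp add: add power2_norm_eq_inner inner_add_left inner_add_right inner_commute)
  qed
  have int: "integrable M ?P" by (simp add: parseval_frame_norm_sq[OF A])
  have "(\<integral>\<alpha>. ?P \<alpha> \<partial>M) = ((norm (h + k))\<^sup>2 - (norm h)\<^sup>2 - (norm k)\<^sup>2) / 2"
    by (simp add: parseval_frame_norm_sq[OF A])
  also have "\<dots> = inner h k"
    by (simp add: power2_norm_eq_inner inner_add_left inner_add_right inner_commute)
  finally show "(\<integral>\<alpha>. inner (A \<alpha> h) (A \<alpha> k) \<partial>M) = inner h k"
    by (simp add: eq cong: Bochner_Integration.integral_cong)
  show "integrable M (\<lambda>\<alpha>. inner (A \<alpha> h) (A \<alpha> k))"
    using int by (simp add: eq cong: Bochner_Integration.integrable_cong)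
qed

lemma integrable_simple_mult:
  fixes u \<phi> :: "'o \<Rightarrow> real"
  assumes u: "simple_function M u" and \<phi>: "integrable M \<phi>"
  shows "integrable M (\<lambda>\<alpha>. u \<alpha> * \<phi> \<alpha>)"
proof -
  have fin: "finite (u ` space M)" using u by (rule simple_functionD)
  define K where "K = Max (insert 0 ((\<lambda>x. \<bar>x\<bar>) ` u ` space M))"
  have K: "\<bar>u \<alpha>\<bar> \<le> K" if "\<alpha> \<in> space M" for \<alpha>
    unfolding K_def using fin that by (intro Max_ge) auto
  show ?thesis
  proof (rule Bochner_Integration.integrable_bound)
    show "integrable M (\<lambda>\<alpha>. K * \<phi> \<alpha>)" using \<phi> by simp
    show "(\<lambda>\<alpha>. u \<alpha> * \<phi> \<alpha>) \<in> borel_measurable M"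
      using borel_measurable_simple_function[OF u] \<phi> by measurable
    show "AE \<alpha> in M. norm (u \<alpha> * \<phi> \<alpha>) \<le> norm (K * \<phi> \<alpha>)"
      using K by (auto intro!: AE_I2 simp: abs_mult intro!: mult_right_mono) (smt (verit))
  qed
qed

text \<open>
  A simple function is used below as a finite partition into its level sets, labelled by its values;
  this lemma turns finite sums over the labels into integrals.
\<close>

lemma integral_simple_mult_level_sets:
  fixes l \<phi> :: "'o \<Rightarrow> real" and c :: "real \<Rightarrow> real"
  assumes l: "simple_function M l" and \<phi>: "integrable M \<phi>"
  shows "(\<Sum>i\<in>l ` space M. c i * (\<integral>\<alpha>. indicator {i} (l \<alpha>) * \<phi> \<alpha> \<partial>M))
    = (\<integral>\<alpha>. c (l \<alpha>) * \<phi> \<alpha> \<partial>M)"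
proof -
  have fin: "finite (l ` space M)" using l by (rule simple_functionD)
  have int: "integrable M (\<lambda>\<alpha>. indicator {i} (l \<alpha>) * \<phi> \<alpha>)" for i
    using \<phi> by (intro integrable_simple_mult simple_function_compose1[OF l])
  have "(\<Sum>i\<in>l ` space M. c i * (\<integral>\<alpha>. indicator {i} (l \<alpha>) * \<phi> \<alpha> \<partial>M))
     = (\<integral>\<alpha>. (\<Sum>i\<in>l ` space M. c i * (indicator {i} (l \<alpha>) * \<phi> \<alpha>)) \<partial>M)"
    using int by simp
  also have "\<dots> = (\<integral>\<alpha>. c (l \<alpha>) * \<phi> \<alpha> \<partial>M)"
  proof (rule Bochner_Integration.integral_cong[OF refl])
    fix \<alpha> assume "\<alpha> \<in> space M"
    then have "(\<Sum>i\<in>l ` space M. c i * (indicator {i} (l \<alpha>) * \<phi> \<alpha>))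
       = (\<Sum>i\<in>l ` space M. if l \<alpha> = i then c i * \<phi> \<alpha> else 0)"
      by (intro sum.cong) auto
    then show "(\<Sum>i\<in>l ` space M. c i * (indicator {i} (l \<alpha>) * \<phi> \<alpha>)) = c (l \<alpha>) * \<phi> \<alpha>"
      using fin \<open>\<alpha> \<in> space M\<close> by (simp add: sum.delta)
  qed
  finally show ?thesis .
qed

text \<open>
  This is the weak integral of \<open>u \<alpha> *\<^sub>R A\<^sub>\<alpha>\<^sup>* A\<^sub>\<alpha> h\<close>, that is the synthesis operator applied to
  the pointwise product of \<open>u\<close> with the analysis coefficients of \<open>h\<close>.  Characterising it by its
  inner products avoids vector-valued integration.
\<close>

definition frame_multiplier ::
    "'o measure \<Rightarrow> ('o \<Rightarrow> 'a::real_inner \<Rightarrow> 'b::real_inner) \<Rightarrow> 'a \<Rightarrow> ('o \<Rightarrow> real) \<Rightarrow> 'a" where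
  "frame_multiplier M A h u =
     (SOME p. \<forall>k. inner k p = (\<integral>\<alpha>. u \<alpha> * inner (A \<alpha> h) (A \<alpha> k) \<partial>M))"

text \<open>
  Integrated form of \<open>2 * inner x y \<le> (norm x)\<^sup>2 + (norm y)\<^sup>2\<close>.  It yields both the continuity
  needed for Riesz representation and, with the representing vector itself as \<open>k\<close>, the contraction
  bound.
\<close>

lemma frame_multiplier_form_bound:
  assumes A: "parseval_frame M A" and u: "simple_function M u"
  shows "2 * (\<integral>\<alpha>. u \<alpha> * inner (A \<alpha> h) (A \<alpha> k) \<partial>M)
    \<le> (\<integral>\<alpha>. (u \<alpha>)\<^sup>2 * (norm (A \<alpha> h))\<^sup>2 \<partial>M) + (norm k)\<^sup>2"
proof -
  note sq = parseval_frame_norm_sq[OF A]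
  have u2: "integrable M (\<lambda>\<alpha>. (u \<alpha>)\<^sup>2 * (norm (A \<alpha> h))\<^sup>2)"
    by (intro integrable_simple_mult simple_function_compose1[OF u] sq)
  have ui: "integrable M (\<lambda>\<alpha>. u \<alpha> * inner (A \<alpha> h) (A \<alpha> k))"
    by (intro integrable_simple_mult u parseval_frame_inner[OF A])
  have "(\<integral>\<alpha>. 2 * (u \<alpha> * inner (A \<alpha> h) (A \<alpha> k)) \<partial>M)
    \<le> (\<integral>\<alpha>. (u \<alpha>)\<^sup>2 * (norm (A \<alpha> h))\<^sup>2 + (norm (A \<alpha> k))\<^sup>2 \<partial>M)"
  proof (rule integral_mono)
    show "2 * (u \<alpha> * inner (A \<alpha> h) (A \<alpha> k)) \<le> (u \<alpha>)\<^sup>2 * (norm (A \<alpha> h))\<^sup>2 + (norm (A \<alpha> k))\<^sup>2" for \<alpha>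
      using inner_ge_zero[of "u \<alpha> *\<^sub>R A \<alpha> h - A \<alpha> k"]
      by (simp add: power2_norm_eq_inner inner_diff_left inner_diff_right inner_commute
          power2_eq_square[of "u \<alpha>"] mult.assoc)
  qed (use u2 ui sq in simp_all)
  then show ?thesis using u2 ui sq by simp
qed

lemma inner_frame_multiplier:
  fixes A :: "'o \<Rightarrow> 'a::{real_inner, complete_space} \<Rightarrow> 'b::real_inner"
  assumes A: "parseval_frame M A" and u: "simple_function M u"
  shows "inner k (frame_multiplier M A h u) = (\<integral>\<alpha>. u \<alpha> * inner (A \<alpha> h) (A \<alpha> k) \<partial>M)"
proof -
  define \<phi> where "\<phi> k = (\<integral>\<alpha>. u \<alpha> * inner (A \<alpha> h) (A \<alpha> k) \<partial>M)" for k
  define W where "W = (\<integral>\<alpha>. (u \<alpha>)\<^sup>2 * (norm (A \<alpha> h))\<^sup>2 \<partial>M)"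
  have ui: "integrable M (\<lambda>\<alpha>. u \<alpha> * inner (A \<alpha> h) (A \<alpha> k))" for k
    by (intro integrable_simple_mult u parseval_frame_inner[OF A])
  have add: "\<phi> (x + y) = \<phi> x + \<phi> y" for x y
  proof -
    have "\<phi> (x + y) = (\<integral>\<alpha>. u \<alpha> * inner (A \<alpha> h) (A \<alpha> x) + u \<alpha> * inner (A \<alpha> h) (A \<alpha> y) \<partial>M)"
      unfolding \<phi>_def
      by (intro Bochner_Integration.integral_cong refl)
        (simp add: linear_add[OF bounded_linear.linear[OF parseval_frame_linear[OF A]]]
          inner_add_right distrib_left)
    then show ?thesis using ui by (simp add: \<phi>_def)
  qed
  have scale: "\<phi> (r *\<^sub>R x) = r * \<phi> x" for r x
  proof -
    have "\<phi> (r *\<^sub>R x) = (\<integral>\<alpha>. r * (u \<alpha> * inner (A \<alpha> h) (A \<alpha> x)) \<partial>M)"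
      unfolding \<phi>_def
      by (intro Bochner_Integration.integral_cong refl)
        (simp add: linear_cmul[OF bounded_linear.linear[OF parseval_frame_linear[OF A]]])
    then show ?thesis by (simp add: \<phi>_def)
  qed
  have "bounded_linear \<phi>"
  proof (rule bounded_linear_intro)
    show "norm (\<phi> x) \<le> norm x * ((W + 1) / 2)" for x
    proof (cases "x = 0")
      case True
      then show ?thesis using scale[of 0 0] by simp
    next
      case False
      (* The quadratic bound, applied to plus and minus the unit vector in the direction of x. *)
      have *: "s * \<phi> x \<le> norm x * ((W + 1) / 2)" if "\<bar>s\<bar> = 1" for s
      proof -
        have "2 * \<phi> ((s / norm x) *\<^sub>R x) \<le> W + (norm ((s / norm x) *\<^sub>R x))\<^sup>2"
          unfolding \<phi>_def W_def by (rule frame_multiplier_form_bound[OF A u])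
        then show ?thesis using False that by (simp add: scale field_simps)
      qed
      show ?thesis using *[of 1] *[of "-1"] by (simp add: abs_le_iff)
    qed
  qed (simp_all add: add scale)
  then obtain v where "\<And>k. \<phi> k = inner k v" using riesz_representation by blast
  then have "\<exists>p. \<forall>k. inner k p = (\<integral>\<alpha>. u \<alpha> * inner (A \<alpha> h) (A \<alpha> k) \<partial>M)"
    unfolding \<phi>_def by metis
  from someI_ex[OF this] show ?thesis unfolding frame_multiplier_def by blast
qed

text \<open>
  The synthesis operator of a Parseval frame is a contraction: this is the \<open>L\<^sup>2\<close> end of the
  interpolation.
\<close>

lemma norm_frame_multiplier:
  fixes A :: "'o \<Rightarrow> 'a::{real_inner, complete_space} \<Rightarrow> 'b::real_inner"
  assumes A: "parseval_frame M A" and u: "simple_function M u"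
  shows "(norm (frame_multiplier M A h u))\<^sup>2 \<le> (\<integral>\<alpha>. (u \<alpha>)\<^sup>2 * (norm (A \<alpha> h))\<^sup>2 \<partial>M)"
  using frame_multiplier_form_bound[OF A u, of h "frame_multiplier M A h u"]
  unfolding inner_frame_multiplier[OF A u, symmetric] power2_norm_eq_inner[symmetric] by simp

lemma frame_multiplier_one:
  fixes A :: "'o \<Rightarrow> 'a::{real_inner, complete_space} \<Rightarrow> 'b::real_inner"
  assumes A: "parseval_frame M A"
  shows "frame_multiplier M A h (\<lambda>_. 1) = h"
proof -
  have "inner k (frame_multiplier M A h (\<lambda>_. 1)) = inner k h" for k
    by (simp add: inner_frame_multiplier[OF A] parseval_frame_inner(2)[OF A] inner_commute)
  then show ?thesis by (rule iffD1[OF vector_eq_ldot, OF allI])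
qed

lemma frame_multiplier_level_sets:
  fixes A :: "'o \<Rightarrow> 'a::{real_inner, complete_space} \<Rightarrow> 'b::real_inner"
    and l :: "'o \<Rightarrow> real" and c :: "real \<Rightarrow> real"
  assumes A: "parseval_frame M A" and l: "simple_function M l"
  shows "frame_multiplier M A h (\<lambda>\<alpha>. c (l \<alpha>))
    = (\<Sum>i\<in>l ` space M. c i *\<^sub>R frame_multiplier M A h (\<lambda>\<alpha>. indicator {i} (l \<alpha>)))"
    (is "_ = ?S")
proof -
  have "inner k (frame_multiplier M A h (\<lambda>\<alpha>. c (l \<alpha>))) = inner k ?S" for k
    by (simp add: inner_sum_right inner_frame_multiplier[OF A]
        simple_function_compose1[OF l] integral_simple_mult_level_sets[OF l]
        parseval_frame_inner[OF A])
  then show ?thesis by (rule iffD1[OF vector_eq_ldot, OF allI])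
qed

text \<open>
  On a finite measure space square-integrability of the coefficients implies their integrability,
  which makes the \<open>L\<^sup>1\<close> end of the interpolation available.
\<close>

lemma parseval_frame_norm_integrable:
  assumes "finite_measure M" and A: "parseval_frame M A"
  shows "integrable M (\<lambda>\<alpha>. norm (A \<alpha> h))"
proof -
  interpret finite_measure M by fact
  show ?thesis
  proof (rule Bochner_Integration.integrable_bound)
    show "integrable M (\<lambda>\<alpha>. 1 + (norm (A \<alpha> h))\<^sup>2)" by (simp add: parseval_frame_norm_sq[OF A])
    have "x \<le> 1 + x\<^sup>2" for x :: real
      using zero_le_power2[of "x - 1/2"] by (simp add: power2_diff field_simps)
    then show "AE \<alpha> in M. norm (norm (A \<alpha> h)) \<le> norm (1 + (norm (A \<alpha> h))\<^sup>2)" by simp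
  qed (rule parseval_frame_norm_measurable[OF A])
qed

text \<open>
  The \<open>L\<^sup>1\<close> end of the interpolation: the pairing has the kernel
  \<open>u \<alpha> * v \<beta> * inner (B\<^sub>\<beta> A\<^sub>\<alpha>\<^sup>* A\<^sub>\<alpha> h) (B\<^sub>\<beta> h)\<close>, which is estimated pointwise.  The integrals are
  taken one after the other, because nothing ensures that the kernel is jointly measurable.
\<close>

lemma inner_frame_multipliers_bound:
  fixes A :: "'o \<Rightarrow> 'a::{real_inner, complete_space} \<Rightarrow> 'b::{real_inner, complete_space}"
    and B :: "'p \<Rightarrow> 'a \<Rightarrow> 'b"
  assumes "finite_measure M" "finite_measure N"
    and A: "parseval_frame M A" and B: "parseval_frame N B"
    and C: "\<And>\<alpha> \<beta> y. \<alpha> \<in> space M \<Longrightarrow> \<beta> \<in> space N \<Longrightarrow>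
      norm (B \<beta> (adjoint (A \<alpha>) y)) \<le> C * norm y"
    and u: "simple_function M u" and v: "simple_function N v"
  shows "\<bar>inner (frame_multiplier M A h u) (frame_multiplier N B h v)\<bar>
    \<le> C * (\<integral>\<alpha>. \<bar>u \<alpha>\<bar> * norm (A \<alpha> h) \<partial>M) * (\<integral>\<beta>. \<bar>v \<beta>\<bar> * norm (B \<beta> h) \<partial>N)"
proof -
  define q where "q = frame_multiplier N B h v"
  define Y where "Y = (\<integral>\<beta>. \<bar>v \<beta>\<bar> * norm (B \<beta> h) \<partial>N)"
  have vB: "integrable N (\<lambda>\<beta>. \<bar>v \<beta>\<bar> * norm (B \<beta> h))"
    by (intro integrable_simple_mult simple_function_compose1[OF v]
        parseval_frame_norm_integrable assms)
  have uA: "integrable M (\<lambda>\<alpha>. \<bar>u \<alpha>\<bar> * norm (A \<alpha> h))"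
    by (intro integrable_simple_mult simple_function_compose1[OF u]
        parseval_frame_norm_integrable assms)
  have inner_bound: "\<bar>inner (A \<alpha> h) (A \<alpha> q)\<bar> \<le> C * norm (A \<alpha> h) * Y" if \<alpha>: "\<alpha> \<in> space M" for \<alpha>
  proof -
    let ?k = "adjoint (A \<alpha>) (A \<alpha> h)"
    have "inner (A \<alpha> h) (A \<alpha> q) = inner ?k q"
      using inner_adjoint[OF parseval_frame_linear[OF A \<alpha>], of q "A \<alpha> h"] by (simp add: inner_commute)
    also have "\<dots> = (\<integral>\<beta>. v \<beta> * inner (B \<beta> h) (B \<beta> ?k) \<partial>N)"
      unfolding q_def by (rule inner_frame_multiplier[OF B v])
    also have "\<bar>\<dots>\<bar> \<le> (\<integral>\<beta>. \<bar>v \<beta> * inner (B \<beta> h) (B \<beta> ?k)\<bar> \<partial>N)"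
      by (rule integral_abs_bound)
    also have "\<dots> \<le> (\<integral>\<beta>. (C * norm (A \<alpha> h)) * (\<bar>v \<beta>\<bar> * norm (B \<beta> h)) \<partial>N)"
    proof (rule integral_mono)
      show "integrable N (\<lambda>\<beta>. \<bar>v \<beta> * inner (B \<beta> h) (B \<beta> ?k)\<bar>)"
        by (intro integrable_abs integrable_simple_mult v parseval_frame_inner[OF B])
      show "integrable N (\<lambda>\<beta>. (C * norm (A \<alpha> h)) * (\<bar>v \<beta>\<bar> * norm (B \<beta> h)))" using vB by simp
      fix \<beta> assume \<beta>: "\<beta> \<in> space N"
      have "\<bar>inner (B \<beta> h) (B \<beta> ?k)\<bar> \<le> norm (B \<beta> h) * norm (B \<beta> ?k)"
        by (rule Cauchy_Schwarz_ineq2)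
      also have "\<dots> \<le> norm (B \<beta> h) * (C * norm (A \<alpha> h))"
        by (intro mult_left_mono C \<alpha> \<beta>) simp
      finally have "\<bar>v \<beta>\<bar> * \<bar>inner (B \<beta> h) (B \<beta> ?k)\<bar> \<le> \<bar>v \<beta>\<bar> * (norm (B \<beta> h) * (C * norm (A \<alpha> h)))"
        by (rule mult_left_mono) simp
      then show "\<bar>v \<beta> * inner (B \<beta> h) (B \<beta> ?k)\<bar> \<le> (C * norm (A \<alpha> h)) * (\<bar>v \<beta>\<bar> * norm (B \<beta> h))"
        by (simp add: abs_mult ac_simps)
    qed
    also have "\<dots> = C * norm (A \<alpha> h) * Y" by (simp add: Y_def)
    finally show ?thesis .
  qed
  have "\<bar>inner (frame_multiplier M A h u) q\<bar> = \<bar>\<integral>\<alpha>. u \<alpha> * inner (A \<alpha> h) (A \<alpha> q) \<partial>M\<bar>"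
    by (subst inner_commute) (simp add: inner_frame_multiplier[OF A u])
  also have "\<dots> \<le> (\<integral>\<alpha>. \<bar>u \<alpha> * inner (A \<alpha> h) (A \<alpha> q)\<bar> \<partial>M)"
    by (rule integral_abs_bound)
  also have "\<dots> \<le> (\<integral>\<alpha>. (C * Y) * (\<bar>u \<alpha>\<bar> * norm (A \<alpha> h)) \<partial>M)"
  proof (rule integral_mono)
    show "integrable M (\<lambda>\<alpha>. \<bar>u \<alpha> * inner (A \<alpha> h) (A \<alpha> q)\<bar>)"
      by (intro integrable_abs integrable_simple_mult u parseval_frame_inner[OF A])
    show "integrable M (\<lambda>\<alpha>. (C * Y) * (\<bar>u \<alpha>\<bar> * norm (A \<alpha> h)))" using uA by simp
    show "\<bar>u \<alpha> * inner (A \<alpha> h) (A \<alpha> q)\<bar> \<le> (C * Y) * (\<bar>u \<alpha>\<bar> * norm (A \<alpha> h))" if "\<alpha> \<in> space M" for \<alpha>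
      using mult_left_mono[OF inner_bound[OF that], of "\<bar>u \<alpha>\<bar>"] by (simp add: abs_mult ac_simps)
  qed
  also have "\<dots> = C * (\<integral>\<alpha>. \<bar>u \<alpha>\<bar> * norm (A \<alpha> h) \<partial>M) * Y" by simp
  finally show ?thesis by (simp add: q_def Y_def)
qed

section \<open>Interpolation between the two bounds\<close>

text \<open>
  With \<open>u z \<alpha> = exp (z * l \<alpha>)\<close> and \<open>v z \<beta> = exp (z * r \<beta>)\<close>, let \<open>F z\<close> be the bilinear pairing of
  the multipliers of \<open>h\<close> by \<open>u z\<close> and \<open>v z\<close>.  As \<open>l\<close> and \<open>r\<close> are simple, \<open>F\<close> is a finite
  exponential sum, hence entire.  On \<open>Re z = 0\<close> the weights are unimodular and both multipliers
  have norm at most 1; on \<open>Re z = 1\<close> the kernel bound applies; and \<open>F 0 = inner h h = 1\<close>.  The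
  derivative of \<open>F\<close> at 0 is the exponent on the left-hand side, so the claim is the derivative
  form of the three lines theorem.

  The space may be real while \<open>z\<close> is complex, so \<open>F\<close> is built from the real matrix \<open>m\<close> of
  pairings of level-set pieces.
\<close>

lemma simple_weight_inequality:
  fixes A :: "'o \<Rightarrow> 'a::{real_inner, complete_space} \<Rightarrow> 'b::{real_inner, complete_space}"
    and B :: "'p \<Rightarrow> 'a \<Rightarrow> 'b"
    and l :: "'o \<Rightarrow> real" and r :: "'p \<Rightarrow> real"
  assumes finM: "finite_measure M" and finN: "finite_measure N"
    and A: "parseval_frame M A" and B: "parseval_frame N B"
    and h: "norm h = 1"
    and C: "\<And>\<alpha> \<beta> y. \<alpha> \<in> space M \<Longrightarrow> \<beta> \<in> space N \<Longrightarrow>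
      norm (B \<beta> (adjoint (A \<alpha>) y)) \<le> C * norm y"
    and C0: "0 \<le> C"
    and l: "simple_function M l" and r: "simple_function N r"
  shows "exp ((\<integral>\<alpha>. l \<alpha> * (norm (A \<alpha> h))\<^sup>2 \<partial>M) + (\<integral>\<beta>. r \<beta> * (norm (B \<beta> h))\<^sup>2 \<partial>N))
    \<le> C * (\<integral>\<alpha>. exp (l \<alpha>) * norm (A \<alpha> h) \<partial>M) * (\<integral>\<beta>. exp (r \<beta>) * norm (B \<beta> h) \<partial>N)"
    (is "exp (?L + ?R) \<le> C * ?S * ?T")
proof -
  let ?I = "l ` space M" and ?J = "r ` space N"
  define W where "W a = frame_multiplier M A h (\<lambda>\<alpha>. a (l \<alpha>))" for a :: "real \<Rightarrow> real"
  define V where "V b = frame_multiplier N B h (\<lambda>\<beta>. b (r \<beta>))" for b :: "real \<Rightarrow> real"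
  define m where "m i j = inner (W (indicator {i})) (V (indicator {j}))" for i j
  have bilinear: "inner (W a) (V b) = (\<Sum>i\<in>?I. \<Sum>j\<in>?J. m i j * (a i * b j))" for a b
  proof -
    have "inner (W a) (V b) = inner (\<Sum>i\<in>?I. a i *\<^sub>R W (indicator {i})) (\<Sum>j\<in>?J. b j *\<^sub>R V (indicator {j}))"
      unfolding W_def V_def
      by (subst frame_multiplier_level_sets[OF A l], subst frame_multiplier_level_sets[OF B r]) simp
    also have "\<dots> = (\<Sum>i\<in>?I. \<Sum>j\<in>?J. m i j * (a i * b j))"
      unfolding inner_sum_left by (simp add: inner_sum_right m_def ac_simps sum_distrib_left)
    finally show ?thesis .
  qed
  have W1: "W (\<lambda>_. 1) = h" and V1: "V (\<lambda>_. 1) = h"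
    by (simp_all add: W_def V_def frame_multiplier_one[OF A] frame_multiplier_one[OF B])
  have hh: "inner h h = 1" using h by (simp add: power2_norm_eq_inner[symmetric])
  define F where "F z = (\<Sum>i\<in>?I. \<Sum>j\<in>?J. of_real (m i j) * exp (of_real (i + j) * z))" for z :: complex
  define D where "D = (\<Sum>i\<in>?I. \<Sum>j\<in>?J. m i j * (i + j))"
  have D: "D = ?L + ?R"
  proof -
    have "D = inner (W (\<lambda>i. i)) (V (\<lambda>_. 1)) + inner (W (\<lambda>_. 1)) (V (\<lambda>j. j))"
      by (simp add: D_def bilinear distrib_left sum.distrib)
    also have "\<dots> = inner h (W (\<lambda>i. i)) + inner h (V (\<lambda>j. j))"
      by (simp add: W1 V1 inner_commute)
    finally show ?thesis
      by (simp add: W_def V_def inner_frame_multiplier[OF A l] inner_frame_multiplier[OF B r]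
          power2_norm_eq_inner)
  qed
  have m_bound: "(\<Sum>i\<in>?I. \<Sum>j\<in>?J. \<bar>m i j\<bar> * exp (i + j)) \<le> C * ?S * ?T"
  proof -
    define X where "X i = (\<integral>\<alpha>. indicator {i} (l \<alpha>) * norm (A \<alpha> h) \<partial>M)" for i
    define Y where "Y j = (\<integral>\<beta>. indicator {j} (r \<beta>) * norm (B \<beta> h) \<partial>N)" for j
    have m_le: "\<bar>m i j\<bar> \<le> C * X i * Y j" for i j
      using inner_frame_multipliers_bound[OF finM finN A B C
          simple_function_compose1[OF l, of "indicator {i}"]
          simple_function_compose1[OF r, of "indicator {j}"]]
      by (simp add: m_def W_def V_def X_def Y_def)
    have "(\<Sum>i\<in>?I. \<Sum>j\<in>?J. \<bar>m i j\<bar> * exp (i + j)) \<le> (\<Sum>i\<in>?I. \<Sum>j\<in>?J. C * X i * Y j * exp (i + j))"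
      by (intro sum_mono mult_right_mono m_le) simp
    also have "\<dots> = C * (\<Sum>i\<in>?I. exp i * X i) * (\<Sum>j\<in>?J. exp j * Y j)"
      by (simp add: sum_product sum_distrib_left exp_add ac_simps)
    also have "\<dots> = C * ?S * ?T"
      unfolding X_def Y_def
      by (simp add: integral_simple_mult_level_sets[OF l] integral_simple_mult_level_sets[OF r]
          parseval_frame_norm_integrable[OF finM A] parseval_frame_norm_integrable[OF finN B])
    finally show ?thesis .
  qed
  (* The three lines theorem asks for a positive constant, so the right-hand side, which might
     vanish, is approached from above. *)
  have bound: "exp D \<le> C'" if "C * ?S * ?T < C'" for C'
  proof -
    have "0 \<le> C * ?S * ?T" using C0 by (intro mult_nonneg_nonneg integral_nonneg_AE) auto
    then have "0 < C'" using that by linarith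
    have "exp (Re (of_real D)) \<le> C'"
    proof (rule three_lines_derivative_bound[of F "\<Sum>i\<in>?I. \<Sum>j\<in>?J. \<bar>m i j\<bar> * exp \<bar>i + j\<bar>"])
      show "F holomorphic_on UNIV" unfolding F_def by (intro holomorphic_intros)
      show "norm (F z) \<le> (\<Sum>i\<in>?I. \<Sum>j\<in>?J. \<bar>m i j\<bar> * exp \<bar>i + j\<bar>)" if z: "0 \<le> Re z" "Re z \<le> 1" for z
        unfolding F_def
      proof (intro sum_norm_le)
        fix i j
        have "(i + j) * Re z \<le> \<bar>i + j\<bar> * 1"
          using z by (intro mult_mono) auto
        then show "norm (of_real (m i j) * exp (of_real (i + j) * z)) \<le> \<bar>m i j\<bar> * exp \<bar>i + j\<bar>"
          unfolding norm_mult by (intro mult_mono) auto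
      qed
      show "norm (F (Complex 1 y)) \<le> C'" for y
      proof -
        have "norm (F (Complex 1 y)) \<le> (\<Sum>i\<in>?I. \<Sum>j\<in>?J. \<bar>m i j\<bar> * exp (i + j))"
          unfolding F_def by (intro sum_norm_le) (simp add: norm_mult)
        then show ?thesis using m_bound that by linarith
      qed
      show "F 0 = 1"
        using bilinear[of "\<lambda>_. 1" "\<lambda>_. 1"] unfolding F_def
        by (simp add: W1 V1 hh of_real_sum[symmetric] del: of_real_sum)
      show "(F has_field_derivative of_real D) (at 0)"
        unfolding F_def D_def by (auto intro!: derivative_eq_intros sum.cong)
      show "norm (F (Complex 0 y)) \<le> 1" for y
      proof -
        (* After a rotation of F to the positive real axis, its modulus is a real part; splitting the
           unimodular weights into cosine and sine then gives four real multipliers, and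
           cos^2 + sin^2 = 1 bounds the sum of their squared norms by 2. *)
        let ?s = "F (Complex 0 y)"
        define t where "t = Arg ?s"
        let ?a = "\<lambda>i. cos (i * y - t)" and ?b = "\<lambda>i. sin (i * y - t)"
          and ?c = "\<lambda>j. cos (j * y)" and ?d = "\<lambda>j. sin (j * y)"
        have "cis (- t) * ?s = of_real (norm ?s)"
          by (subst (2) rcis_cmod_Arg[symmetric]) (simp add: t_def rcis_def cis_mult)
        then have "norm ?s = Re (cis (- t) * ?s)" by simp
        also have "\<dots> = (\<Sum>i\<in>?I. \<Sum>j\<in>?J. m i j * (?a i * ?c j)) - (\<Sum>i\<in>?I. \<Sum>j\<in>?J. m i j * (?b i * ?d j))"
        proof -
          have "cis (- t) * ?s = (\<Sum>i\<in>?I. \<Sum>j\<in>?J. of_real (m i j) * cis ((i * y - t) + j * y))"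
          proof -
            have "cis (- t) * (of_real (m i j) * exp (of_real (i + j) * Complex 0 y))
              = of_real (m i j) * cis ((i * y - t) + j * y)" for i j
            proof -
              have "of_real (i + j) * Complex 0 y = \<i> * of_real ((i + j) * y)"
                by (simp add: complex_eq_iff)
              then have "exp (of_real (i + j) * Complex 0 y) = cis ((i + j) * y)"
                by (simp only: cis_conv_exp)
              then show ?thesis by (simp add: cis_mult algebra_simps)
            qed
            then show ?thesis unfolding F_def sum_distrib_left by (intro sum.cong refl)
          qed
          then show ?thesis
            by (simp add: cos_add right_diff_distrib sum_subtractf)
        qed
        also have "\<dots> = inner (W ?a) (V ?c) - inner (W ?b) (V ?d)" by (simp add: bilinear)
        also have "\<dots> \<le> ((norm (W ?a))\<^sup>2 + (norm (V ?c))\<^sup>2 + (norm (W ?b))\<^sup>2 + (norm (V ?d))\<^sup>2) / 2"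
          using zero_le_power2[of "norm (W ?a - V ?c)"] zero_le_power2[of "norm (W ?b + V ?d)"]
          by (simp add: power2_norm_eq_inner inner_diff_left inner_diff_right inner_add_left
              inner_add_right inner_commute)
        also have "\<dots> \<le> 1"
        proof -
          have "(norm (W ?a))\<^sup>2 + (norm (W ?b))\<^sup>2
            \<le> (\<integral>\<alpha>. (?a (l \<alpha>))\<^sup>2 * (norm (A \<alpha> h))\<^sup>2 \<partial>M) + (\<integral>\<alpha>. (?b (l \<alpha>))\<^sup>2 * (norm (A \<alpha> h))\<^sup>2 \<partial>M)"
            unfolding W_def
            by (intro add_mono norm_frame_multiplier[OF A] simple_function_compose1[OF l])
          also have "\<dots> = (\<integral>\<alpha>. (?a (l \<alpha>))\<^sup>2 * (norm (A \<alpha> h))\<^sup>2 + (?b (l \<alpha>))\<^sup>2 * (norm (A \<alpha> h))\<^sup>2 \<partial>M)"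
            by (intro Bochner_Integration.integral_add[symmetric] integrable_simple_mult
                simple_function_compose1[OF l] parseval_frame_norm_sq[OF A])
          also have "\<dots> = 1"
            by (simp add: distrib_right[symmetric] parseval_frame_norm_sq[OF A] h)
          finally have 1: "(norm (W ?a))\<^sup>2 + (norm (W ?b))\<^sup>2 \<le> 1" .
          have "(norm (V ?c))\<^sup>2 + (norm (V ?d))\<^sup>2
            \<le> (\<integral>\<alpha>. (?c (r \<alpha>))\<^sup>2 * (norm (B \<alpha> h))\<^sup>2 \<partial>N) + (\<integral>\<alpha>. (?d (r \<alpha>))\<^sup>2 * (norm (B \<alpha> h))\<^sup>2 \<partial>N)"
            unfolding V_def
            by (intro add_mono norm_frame_multiplier[OF B] simple_function_compose1[OF r])
          also have "\<dots> = (\<integral>\<alpha>. (?c (r \<alpha>))\<^sup>2 * (norm (B \<alpha> h))\<^sup>2 + (?d (r \<alpha>))\<^sup>2 * (norm (B \<alpha> h))\<^sup>2 \<partial>N)"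
            by (intro Bochner_Integration.integral_add[symmetric] integrable_simple_mult
                simple_function_compose1[OF r] parseval_frame_norm_sq[OF B])
          also have "\<dots> = 1"
            by (simp add: distrib_right[symmetric] parseval_frame_norm_sq[OF B] h)
          finally show ?thesis using 1 by simp
        qed
        finally show ?thesis .
      qed
    qed (rule \<open>0 < C'\<close>)
    then show ?thesis by simp
  qed
  then have "exp D \<le> C * ?S * ?T" by (rule dense_ge)
  then show ?thesis by (simp add: D)
qed

section \<open>Passage from simple weights to the logarithm\<close>

text \<open>
  The logarithm cut off to \<open>{-n..n}\<close> and rounded down to a multiple of \<open>1/n\<close>.  Rounding down
  keeps its exponential below the argument up to the cut-off error \<open>exp (- n)\<close>.
\<close>

definition discrete_log :: "nat \<Rightarrow> real \<Rightarrow> real" where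
  "discrete_log n t = real_of_int \<lfloor>real n * max (- real n) (min (ln t) (real n))\<rfloor> / real n"

lemma simple_function_discrete_log:
  assumes [measurable]: "f \<in> borel_measurable M"
  shows "simple_function M (\<lambda>x. discrete_log n (f x))"
proof (rule simple_function_borel_measurable)
  show "(\<lambda>x. discrete_log n (f x)) \<in> borel_measurable M"
    unfolding discrete_log_def by measurable
  have "discrete_log n t \<in> (\<lambda>k. real_of_int k / real n) ` {- (int n * int n)..int n * int n}" for t
  proof -
    define c where "c = max (- real n) (min (ln t) (real n))"
    have "- real n \<le> c" "c \<le> real n" by (auto simp: c_def)
    then have "real n * - real n \<le> real n * c" "real n * c \<le> real n * real n"
      by (intro mult_left_mono; simp)+
    then have "\<lfloor>real n * c\<rfloor> \<in> {- (int n * int n)..int n * int n}"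
      by (simp add: le_floor_iff floor_le_iff)
    then show ?thesis unfolding discrete_log_def c_def by (rule imageI)
  qed
  then show "finite ((\<lambda>x. discrete_log n (f x)) ` space M)"
    by (intro finite_subset[OF _ finite_imageI[OF finite_atLeastAtMost_int]]) blast
qed

lemma discrete_log_ge:
  assumes "0 < n"
  shows "min (ln t) (real n) - 1 / real n \<le> discrete_log n t"
proof -
  define c where "c = max (- real n) (min (ln t) (real n))"
  have "real n * c - 1 \<le> real_of_int \<lfloor>real n * c\<rfloor>" by linarith
  then have "(real n * c - 1) / real n \<le> discrete_log n t"
    unfolding discrete_log_def c_def by (rule divide_right_mono) simp
  then have "c - 1 / real n \<le> discrete_log n t" using assms by (simp add: diff_divide_distrib)
  then show ?thesis by (simp add: c_def)
qed

lemma exp_discrete_log_le: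
  assumes "0 < n" "0 < t"
  shows "exp (discrete_log n t) \<le> t + exp (- real n)"
proof -
  define c where "c = max (- real n) (min (ln t) (real n))"
  have "discrete_log n t \<le> c"
    using assms of_int_floor_le[of "real n * c"]
    by (simp add: discrete_log_def c_def[symmetric] divide_le_eq mult.commute)
  then have "exp (discrete_log n t) \<le> exp (max (- real n) (ln t))"
    by (simp add: c_def)
  also have "\<dots> \<le> t + exp (- real n)" using assms by (simp add: max_def)
  finally show ?thesis .
qed

text \<open>
  Only the upper cut-off matters for integrability: \<open>t\<^sup>2 * ln t\<close> is bounded below by \<open>- t\<close>, so small
  coefficients do no harm on a finite measure space.
\<close>

lemma integrable_capped_log:
  assumes fin: "finite_measure M" and A: "parseval_frame M A"
    and pos: "\<And>\<alpha>. \<alpha> \<in> space M \<Longrightarrow> 0 < norm (A \<alpha> h)"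
  shows "integrable M (\<lambda>\<alpha>. min (ln (norm (A \<alpha> h))) (real n) * (norm (A \<alpha> h))\<^sup>2)"
proof (rule Bochner_Integration.integrable_bound)
  have [measurable]: "(\<lambda>\<alpha>. norm (A \<alpha> h)) \<in> borel_measurable M"
    by (rule parseval_frame_norm_measurable[OF A])
  show "(\<lambda>\<alpha>. min (ln (norm (A \<alpha> h))) (real n) * (norm (A \<alpha> h))\<^sup>2) \<in> borel_measurable M"
    by measurable
  show "integrable M (\<lambda>\<alpha>. real n * (norm (A \<alpha> h))\<^sup>2 + norm (A \<alpha> h))"
    using parseval_frame_norm_sq[OF A] parseval_frame_norm_integrable[OF fin A] by simp
  have "\<bar>min (ln t) (real n) * t\<^sup>2\<bar> \<le> real n * t\<^sup>2 + t" if t: "0 < t" for t :: real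
  proof (cases "1 \<le> t")
    case True
    then have "0 \<le> min (ln t) (real n)" "min (ln t) (real n) \<le> real n" by auto
    then show ?thesis using t by (simp add: abs_mult add_increasing2 mult_right_mono)
  next
    case False
    then have "ln t < 0" using t by simp
    moreover from this have "min (ln t) (real n) = ln t" by simp
    ultimately have "\<bar>min (ln t) (real n) * t\<^sup>2\<bar> = ln (1 / t) * t\<^sup>2"
      using t by (simp add: abs_mult ln_div)
    also have "\<dots> \<le> (1 / t - 1) * t\<^sup>2" using t by (intro mult_right_mono ln_le_minus_one) auto
    also have "\<dots> \<le> t" using t by (simp add: power2_eq_square field_simps)
    finally show ?thesis by (simp add: add_increasing)
  qed
  then have "norm (min (ln (norm (A \<alpha> h))) (real n) * (norm (A \<alpha> h))\<^sup>2)
     \<le> norm (real n * (norm (A \<alpha> h))\<^sup>2 + norm (A \<alpha> h))" if "\<alpha> \<in> space M" for \<alpha>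
    using pos[OF that] by (auto intro: order_trans[OF _ abs_ge_self])
  then show "AE \<alpha> in M. norm (min (ln (norm (A \<alpha> h))) (real n) * (norm (A \<alpha> h))\<^sup>2)
     \<le> norm (real n * (norm (A \<alpha> h))\<^sup>2 + norm (A \<alpha> h))" by (rule AE_I2)
qed

lemma discrete_log_integrals:
  assumes fin: "finite_measure M" and A: "parseval_frame M A" and h: "norm h = 1"
    and pos: "\<And>\<alpha>. \<alpha> \<in> space M \<Longrightarrow> 0 < norm (A \<alpha> h)"
    and n: "0 < n" "m \<le> n"
  shows "(\<integral>\<alpha>. min (ln (norm (A \<alpha> h))) (real m) * (norm (A \<alpha> h))\<^sup>2 \<partial>M) - 1 / real n
      \<le> (\<integral>\<alpha>. discrete_log n (norm (A \<alpha> h)) * (norm (A \<alpha> h))\<^sup>2 \<partial>M)" (is ?weight)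
    and "(\<integral>\<alpha>. exp (discrete_log n (norm (A \<alpha> h))) * norm (A \<alpha> h) \<partial>M)
      \<le> 1 + exp (- real n) * (\<integral>\<alpha>. norm (A \<alpha> h) \<partial>M)" (is ?mass)
proof -
  let ?f = "\<lambda>\<alpha>. norm (A \<alpha> h)"
  note int1 = parseval_frame_norm_integrable[OF fin A, of h]
  note int2 = parseval_frame_norm_sq[OF A, of h]
  note simp_log = simple_function_discrete_log[OF parseval_frame_norm_measurable[OF A]]
  have "(\<integral>\<alpha>. min (ln (?f \<alpha>)) (real m) * (?f \<alpha>)\<^sup>2 - 1 / real n * (?f \<alpha>)\<^sup>2 \<partial>M)
    \<le> (\<integral>\<alpha>. discrete_log n (?f \<alpha>) * (?f \<alpha>)\<^sup>2 \<partial>M)"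
  proof (rule integral_mono)
    show "integrable M (\<lambda>\<alpha>. min (ln (?f \<alpha>)) (real m) * (?f \<alpha>)\<^sup>2 - 1 / real n * (?f \<alpha>)\<^sup>2)"
      by (intro Bochner_Integration.integrable_diff integrable_capped_log fin A pos
          integrable_mult_right int2)
    show "integrable M (\<lambda>\<alpha>. discrete_log n (?f \<alpha>) * (?f \<alpha>)\<^sup>2)"
      by (intro integrable_simple_mult simp_log int2)
    fix \<alpha>
    have "min (ln (?f \<alpha>)) (real m) - 1 / real n \<le> discrete_log n (?f \<alpha>)"
      using discrete_log_ge[OF n(1), of "?f \<alpha>"] n(2) by linarith
    from mult_right_mono[OF this, of "(?f \<alpha>)\<^sup>2"]
    show "min (ln (?f \<alpha>)) (real m) * (?f \<alpha>)\<^sup>2 - 1 / real n * (?f \<alpha>)\<^sup>2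
      \<le> discrete_log n (?f \<alpha>) * (?f \<alpha>)\<^sup>2"
      by (simp add: left_diff_distrib)
  qed
  then show ?weight using integrable_capped_log[OF fin A pos] int2 h by simp
  have "(\<integral>\<alpha>. exp (discrete_log n (?f \<alpha>)) * ?f \<alpha> \<partial>M)
    \<le> (\<integral>\<alpha>. (?f \<alpha>)\<^sup>2 + exp (- real n) * ?f \<alpha> \<partial>M)"
  proof (rule integral_mono)
    show "integrable M (\<lambda>\<alpha>. exp (discrete_log n (?f \<alpha>)) * ?f \<alpha>)"
      by (intro integrable_simple_mult simple_function_compose1[OF simp_log] int1)
    show "integrable M (\<lambda>\<alpha>. (?f \<alpha>)\<^sup>2 + exp (- real n) * ?f \<alpha>)" using int1 int2 by simp
    fix \<alpha> assume "\<alpha> \<in> space M"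
    from mult_right_mono[OF exp_discrete_log_le[OF n(1) pos[OF this]], of "?f \<alpha>"]
    show "exp (discrete_log n (?f \<alpha>)) * ?f \<alpha> \<le> (?f \<alpha>)\<^sup>2 + exp (- real n) * ?f \<alpha>"
      by (simp add: power2_eq_square distrib_right)
  qed
  then show ?mass using int1 int2 h by simp
qed

text \<open>
  The optimal weights in \<open>simple_weight_inequality\<close> are the logarithms of the coefficients: both
  integrals on the right-hand side then become the Parseval integral, which is 1.
  Their discretisations attain this up to errors that vanish as the discretisation is refined,
  while the cap \<open>m\<close> stays fixed.
\<close>

lemma capped_log_inequality:
  fixes A :: "'o \<Rightarrow> 'a::{real_inner, complete_space} \<Rightarrow> 'b::{real_inner, complete_space}"
    and B :: "'p \<Rightarrow> 'a \<Rightarrow> 'b"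
  assumes finM: "finite_measure M" and finN: "finite_measure N"
    and A: "parseval_frame M A" and B: "parseval_frame N B"
    and h: "norm h = 1"
    and C: "\<And>\<alpha> \<beta> y. \<alpha> \<in> space M \<Longrightarrow> \<beta> \<in> space N \<Longrightarrow>
      norm (B \<beta> (adjoint (A \<alpha>) y)) \<le> C * norm y"
    and C0: "0 \<le> C"
    and posA: "\<And>\<alpha>. \<alpha> \<in> space M \<Longrightarrow> 0 < norm (A \<alpha> h)"
    and posB: "\<And>\<beta>. \<beta> \<in> space N \<Longrightarrow> 0 < norm (B \<beta> h)"
  shows "exp ((\<integral>\<alpha>. min (ln (norm (A \<alpha> h))) (real m) * (norm (A \<alpha> h))\<^sup>2 \<partial>M)
    + (\<integral>\<beta>. min (ln (norm (B \<beta> h))) (real m) * (norm (B \<beta> h))\<^sup>2 \<partial>N)) \<le> C"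
    (is "exp (?a + ?b) \<le> C")
proof -
  let ?K = "\<integral>\<alpha>. norm (A \<alpha> h) \<partial>M" and ?L = "\<integral>\<beta>. norm (B \<beta> h) \<partial>N"
  have bound: "exp (?a - 1 / real n + (?b - 1 / real n))
      \<le> C * (1 + exp (- real n) * ?K) * (1 + exp (- real n) * ?L)"
    if n: "0 < n" "m \<le> n" for n
  proof -
    note dA = discrete_log_integrals[OF finM A h posA n]
    note dB = discrete_log_integrals[OF finN B h posB n]
    have "exp (?a - 1 / real n + (?b - 1 / real n))
      \<le> exp ((\<integral>\<alpha>. discrete_log n (norm (A \<alpha> h)) * (norm (A \<alpha> h))\<^sup>2 \<partial>M)
        + (\<integral>\<beta>. discrete_log n (norm (B \<beta> h)) * (norm (B \<beta> h))\<^sup>2 \<partial>N))"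
      unfolding exp_le_cancel_iff by (intro add_mono dA dB)
    also have "\<dots> \<le> C * (\<integral>\<alpha>. exp (discrete_log n (norm (A \<alpha> h))) * norm (A \<alpha> h) \<partial>M)
        * (\<integral>\<beta>. exp (discrete_log n (norm (B \<beta> h))) * norm (B \<beta> h) \<partial>N)"
      by (intro simple_weight_inequality finM finN A B h C C0
          simple_function_discrete_log parseval_frame_norm_measurable)
    also have "\<dots> \<le> C * (1 + exp (- real n) * ?K) * (1 + exp (- real n) * ?L)"
      by (intro mult_mono mult_left_mono dA dB C0 mult_nonneg_nonneg add_nonneg_nonneg)
        (auto intro!: Bochner_Integration.integral_nonneg)
    finally show ?thesis .
  qed
  have e0: "(\<lambda>n. exp (- real n)) \<longlonglongrightarrow> 0"
    by (rule filterlim_compose[OF exp_at_bot])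
      (simp add: filterlim_uminus_at_top[symmetric] filterlim_real_sequentially)
  have n0: "(\<lambda>n. 1 / real n) \<longlonglongrightarrow> 0" by (rule lim_1_over_n)
  have "(\<lambda>n. exp (?a - 1 / real n + (?b - 1 / real n))) \<longlonglongrightarrow> exp (?a - 0 + (?b - 0))"
    by (intro tendsto_intros n0)
  moreover have "(\<lambda>n. C * (1 + exp (- real n) * ?K) * (1 + exp (- real n) * ?L))
      \<longlonglongrightarrow> C * (1 + 0 * ?K) * (1 + 0 * ?L)"
    by (intro tendsto_intros e0)
  ultimately have "exp (?a - 0 + (?b - 0)) \<le> C * (1 + 0 * ?K) * (1 + 0 * ?L)"
    by (rule LIMSEQ_le) (use bound in \<open>auto intro!: exI[of _ "Suc m"]\<close>)
  then show ?thesis by simp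
qed

text \<open>
  The capped integrals increase with the cap, and their sum is bounded by \<open>ln C\<close>; hence each
  sequence is bounded and monotone convergence applies.  In particular both entropies are finite
  as soon as the operator norms are bounded.
\<close>

lemma log_inequality:
  fixes A :: "'o \<Rightarrow> 'a::{real_inner, complete_space} \<Rightarrow> 'b::{real_inner, complete_space}"
    and B :: "'p \<Rightarrow> 'a \<Rightarrow> 'b"
  assumes finM: "finite_measure M" and finN: "finite_measure N"
    and A: "parseval_frame M A" and B: "parseval_frame N B"
    and h: "norm h = 1"
    and C: "\<And>\<alpha> \<beta> y. \<alpha> \<in> space M \<Longrightarrow> \<beta> \<in> space N \<Longrightarrow>
      norm (B \<beta> (adjoint (A \<alpha>) y)) \<le> C * norm y"
    and C0: "0 \<le> C"
    and posA: "\<And>\<alpha>. \<alpha> \<in> space M \<Longrightarrow> 0 < norm (A \<alpha> h)"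
    and posB: "\<And>\<beta>. \<beta> \<in> space N \<Longrightarrow> 0 < norm (B \<beta> h)"
  shows "integrable M (\<lambda>\<alpha>. ln (norm (A \<alpha> h)) * (norm (A \<alpha> h))\<^sup>2)" (is "integrable M ?u")
    and "integrable N (\<lambda>\<beta>. ln (norm (B \<beta> h)) * (norm (B \<beta> h))\<^sup>2)" (is "integrable N ?v")
    and "0 < C"
    and "(\<integral>\<alpha>. ln (norm (A \<alpha> h)) * (norm (A \<alpha> h))\<^sup>2 \<partial>M)
      + (\<integral>\<beta>. ln (norm (B \<beta> h)) * (norm (B \<beta> h))\<^sup>2 \<partial>N) \<le> ln C"
proof -
  define U where "U n \<alpha> = min (ln (norm (A \<alpha> h))) (real n) * (norm (A \<alpha> h))\<^sup>2" for n \<alpha>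
  define V where "V n \<beta> = min (ln (norm (B \<beta> h))) (real n) * (norm (B \<beta> h))\<^sup>2" for n \<beta>
  define a where "a n = (\<integral>\<alpha>. U n \<alpha> \<partial>M)" for n
  define b where "b n = (\<integral>\<beta>. V n \<beta> \<partial>N)" for n
  have exp_le: "exp (a n + b n) \<le> C" for n
    unfolding a_def b_def U_def V_def
    by (rule capped_log_inequality[OF finM finN A B h C C0 posA posB])
  show "0 < C" using exp_le[of 0] exp_gt_zero less_le_trans by blast
  then have ab: "a n + b n \<le> ln C" for n
    using exp_le[of n] by (simp add: ln_ge_iff)
  have intU: "integrable M (U n)" and intV: "integrable N (V n)" for n
    unfolding U_def V_def
    by (intro integrable_capped_log finM finN A B posA posB; assumption)+
  have mono: "mono (\<lambda>n. U n \<alpha>)" "mono (\<lambda>n. V n \<beta>)" for \<alpha> \<beta>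
    by (auto simp: U_def V_def intro!: monoI mult_right_mono)
  have "incseq a" "incseq b"
    unfolding a_def b_def
    by (intro monoI integral_mono intU intV monoD[OF mono(1)] monoD[OF mono(2)]; assumption)+
  have "a n \<le> ln C - b 0" "b n \<le> ln C - a 0" for n
    using ab[of n] incseqD[OF \<open>incseq a\<close>, of 0 n] incseqD[OF \<open>incseq b\<close>, of 0 n] by auto
  then obtain La Lb where La: "a \<longlonglongrightarrow> La" and Lb: "b \<longlonglongrightarrow> Lb"
    using incseq_convergent[OF \<open>incseq a\<close>] incseq_convergent[OF \<open>incseq b\<close>] by metis
  have cap_lim: "(\<lambda>n. min s (real n) * w) \<longlonglongrightarrow> s * w" for s w :: real
  proof (rule tendsto_eventually)
    show "\<forall>\<^sub>F n in sequentially. min s (real n) * w = s * w"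
      using eventually_ge_at_top[of "nat \<lceil>s\<rceil>"]
    proof eventually_elim
      case (elim n)
      then have "s \<le> real n" by linarith
      then show ?case by (simp add: min_def)
    qed
  qed
  have [measurable]: "(\<lambda>\<alpha>. norm (A \<alpha> h)) \<in> borel_measurable M" "(\<lambda>\<beta>. norm (B \<beta> h)) \<in> borel_measurable N"
    by (rule parseval_frame_norm_measurable[OF A] parseval_frame_norm_measurable[OF B])+
  have limU: "AE \<alpha> in M. (\<lambda>n. U n \<alpha>) \<longlonglongrightarrow> ?u \<alpha>" and limV: "AE \<beta> in N. (\<lambda>n. V n \<beta>) \<longlonglongrightarrow> ?v \<beta>"
    by (simp_all add: U_def V_def cap_lim)
  have monoU: "AE \<alpha> in M. mono (\<lambda>n. U n \<alpha>)" and monoV: "AE \<beta> in N. mono (\<lambda>n. V n \<beta>)"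
    by (simp_all add: mono)
  have u_meas: "?u \<in> borel_measurable M" and v_meas: "?v \<in> borel_measurable N" by measurable
  have u: "has_bochner_integral M ?u La"
    by (rule has_bochner_integral_monotone_convergence[OF intU monoU limU La[unfolded a_def] u_meas])
  have v: "has_bochner_integral N ?v Lb"
    by (rule has_bochner_integral_monotone_convergence[OF intV monoV limV Lb[unfolded b_def] v_meas])
  show "integrable M ?u" "integrable N ?v" using u v by (simp_all only: has_bochner_integral_iff)
  have "La + Lb \<le> ln C"
    using ab by (intro LIMSEQ_le_const2[OF tendsto_add[OF La Lb]]) auto
  then show "integral\<^sup>L M ?u + integral\<^sup>L N ?v \<le> ln C"
    using u v by (simp only: has_bochner_integral_iff)
qed

section \<open>Entropy bounds\<close>

lemma extended_integral_ge:
  assumes g: "integrable M g" and [measurable]: "f \<in> borel_measurable M"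
    and le: "\<And>x. x \<in> space M \<Longrightarrow> g x \<le> f x"
  shows "ereal (integral\<^sup>L M g) \<le> extended_integral M f"
proof -
  have "(\<integral>\<^sup>+x. ennreal (- f x) \<partial>M) \<le> (\<integral>\<^sup>+x. ennreal (- g x) \<partial>M)"
    using le by (intro nn_integral_mono ennreal_leI) auto
  also have "\<dots> < \<infinity>" using g by (auto simp: real_integrable_def less_top)
  finally have neg: "(\<integral>\<^sup>+x. ennreal (- f x) \<partial>M) < \<infinity>" .
  show ?thesis
  proof (cases "(\<integral>\<^sup>+x. ennreal (f x) \<partial>M) = \<infinity>")
    case True
    moreover obtain b where "0 \<le> b" "(\<integral>\<^sup>+x. ennreal (- f x) \<partial>M) = ennreal b"
      using neg by (metis ennreal_cases infinity_ennreal_def less_irrefl)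
    ultimately show ?thesis by (simp add: extended_integral_def enn2ereal_ennreal)
  next
    case False
    then have f: "integrable M f" using neg by (simp add: real_integrable_def)
    show ?thesis
      using integral_mono[OF g f le] by (simp add: extended_integral_eq_integral[OF f])
  qed
qed

text \<open>
  Jensen's inequality in tangent form: integrate
  \<open>p * ln p \<ge> p * (1 - ln \<mu>) - 1 / \<mu>\<close>, where \<open>\<mu>\<close> is the total mass, the right-hand side being
  the tangent line at the constant density \<open>1 / \<mu>\<close>.
\<close>

lemma shannon_entropy_le:
  assumes fin: "finite_measure M" and A: "parseval_frame M A" and h: "h \<in> entropy_domain M A"
  shows "0 < measure M (space M)"
    and "shannon_entropy M A h \<le> ereal (ln (measure M (space M)))"
proof -
  interpret finite_measure M by fact
  let ?f = "\<lambda>\<alpha>. (norm (A \<alpha> h))\<^sup>2" and ?\<mu> = "measure M (space M)"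
  have h1: "norm h = 1" and pos: "\<And>\<alpha>. \<alpha> \<in> space M \<Longrightarrow> 0 < ?f \<alpha>"
    using h by (auto simp: entropy_domain_def)
  note int = parseval_frame_norm_sq[OF A, of h]
  show \<mu>: "0 < ?\<mu>"
  proof (rule ccontr)
    assume "\<not> 0 < ?\<mu>"
    then have "?\<mu> = 0" using measure_nonneg[of M "space M"] by linarith
    then have "AE \<alpha> in M. ?f \<alpha> = 0"
      by (intro AE_I[of _ _ "space M"]) (auto simp: emeasure_eq_measure)
    then have "integral\<^sup>L M ?f = 0" by (rule integral_eq_zero_AE)
    then show False using int(2) h1 by simp
  qed
  let ?g = "\<lambda>\<alpha>. (1 - ln ?\<mu>) * ?f \<alpha> - 1 / ?\<mu>"
  have "integral\<^sup>L M ?g = - ln ?\<mu>" using int \<mu> h1 by simp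
  moreover have "ereal (integral\<^sup>L M ?g) \<le> extended_integral M (\<lambda>\<alpha>. ?f \<alpha> * ln (?f \<alpha>))"
  proof (rule extended_integral_ge)
    show "integrable M ?g" using int by simp
    have [measurable]: "?f \<in> borel_measurable M" using int(1) by simp
    show "(\<lambda>\<alpha>. ?f \<alpha> * ln (?f \<alpha>)) \<in> borel_measurable M" by measurable
    fix \<alpha> assume "\<alpha> \<in> space M"
    then have f: "0 < ?f \<alpha>" by (rule pos)
    have "- (ln (?f \<alpha>) + ln ?\<mu>) = ln (1 / (?f \<alpha> * ?\<mu>))"
      using f \<mu> by (simp add: ln_div ln_mult)
    also have "\<dots> \<le> 1 / (?f \<alpha> * ?\<mu>) - 1" using f \<mu> by (intro ln_le_minus_one) auto
    finally have "?f \<alpha> * (1 - 1 / (?f \<alpha> * ?\<mu>)) \<le> ?f \<alpha> * (ln (?f \<alpha>) + ln ?\<mu>)"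
      using f by (intro mult_left_mono) auto
    moreover have "?f \<alpha> * (1 - 1 / (?f \<alpha> * ?\<mu>)) = ?f \<alpha> - 1 / ?\<mu>"
      using f \<mu> by (simp add: right_diff_distrib)
    ultimately show "?g \<alpha> \<le> ?f \<alpha> * ln (?f \<alpha>)" by (simp add: algebra_simps)
  qed
  ultimately have "ereal (- ln ?\<mu>) \<le> extended_integral M (\<lambda>\<alpha>. ?f \<alpha> * ln (?f \<alpha>))" by simp
  then show "shannon_entropy M A h \<le> ereal (ln ?\<mu>)"
    unfolding shannon_entropy_def by (subst ereal_uminus_le_reorder) simp
qed

lemma shannon_entropy_eq:
  assumes "integrable M (\<lambda>\<alpha>. ln (norm (A \<alpha> h)) * (norm (A \<alpha> h))\<^sup>2)"
  shows "shannon_entropy M A h = ereal (- 2 * (\<integral>\<alpha>. ln (norm (A \<alpha> h)) * (norm (A \<alpha> h))\<^sup>2 \<partial>M))"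
proof -
  have "(norm (A \<alpha> h))\<^sup>2 * ln ((norm (A \<alpha> h))\<^sup>2) = 2 * (ln (norm (A \<alpha> h)) * (norm (A \<alpha> h))\<^sup>2)"
    for \<alpha> by (cases "A \<alpha> h = 0") (simp_all add: ln_realpow)
  then show ?thesis
    unfolding shannon_entropy_def
    using extended_integral_eq_integral[OF Bochner_Integration.integrable_mult_right[OF assms, of 2]]
    by (simp only:) simp
qed

text \<open>
  An infinite supremum makes the lower bound \<open>- \<infinity>\<close>.  Otherwise the supremum serves as the
  constant \<open>C\<close> of \<open>log_inequality\<close>, which also shows it to be positive.
\<close>

lemma parseval_entropy_bounds:
  fixes A :: "'o \<Rightarrow> 'a::{real_inner, complete_space} \<Rightarrow> 'b::{real_inner, complete_space}"
    and B :: "'p \<Rightarrow> 'a \<Rightarrow> 'b"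
  assumes finM: "finite_measure M" and finN: "finite_measure N"
    and A: "parseval_frame M A" and B: "parseval_frame N B"
    and h: "h \<in> entropy_domain M A \<inter> entropy_domain N B"
  shows "shannon_entropy M A h + shannon_entropy N B h
      \<le> ereal (ln (measure M (space M) * measure N (space N)))"
    and "- 2 * ereal_ln (SUP (\<alpha>, \<beta>) \<in> space M \<times> space N. ereal (onorm (B \<beta> \<circ> adjoint (A \<alpha>))))
      \<le> shannon_entropy M A h + shannon_entropy N B h" (is "- 2 * ereal_ln ?c \<le> _")
proof -
  have hA: "h \<in> entropy_domain M A" and hB: "h \<in> entropy_domain N B" using h by auto
  note eA = shannon_entropy_le[OF finM A hA] and eB = shannon_entropy_le[OF finN B hB]
  show "shannon_entropy M A h + shannon_entropy N B h
      \<le> ereal (ln (measure M (space M) * measure N (space N)))"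
    using add_mono[OF eA(2) eB(2)] eA(1) eB(1) by (simp add: ln_mult)
  show "- 2 * ereal_ln ?c \<le> shannon_entropy M A h + shannon_entropy N B h"
  proof (cases "?c = \<infinity>")
    case True
    then show ?thesis by (simp add: ereal_ln_def)
  next
    case False
    (* The maximum covers suprema over an empty index set; C > 0 below rules this case out. *)
    define C where "C = real_of_ereal (max 0 ?c)"
    have C: "ereal C = max 0 ?c"
      unfolding C_def using False by (intro ereal_real') (auto simp: max_def)
    have bound: "norm (B \<beta> (adjoint (A \<alpha>) y)) \<le> C * norm y"
      if "\<alpha> \<in> space M" "\<beta> \<in> space N" for \<alpha> \<beta> y
    proof -
      have "bounded_linear (B \<beta> \<circ> adjoint (A \<alpha>))"
        unfolding comp_def
        by (intro bounded_linear_compose[OF parseval_frame_linear[OF B]] bounded_linear_adjoint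
            parseval_frame_linear[OF A] that)
      from onorm[OF this, of y]
      have "norm (B \<beta> (adjoint (A \<alpha>) y)) \<le> onorm (B \<beta> \<circ> adjoint (A \<alpha>)) * norm y" by simp
      moreover have "ereal (onorm (B \<beta> \<circ> adjoint (A \<alpha>))) \<le> ?c"
        by (rule SUP_upper2[of "(\<alpha>, \<beta>)"]) (use that in auto)
      then have "ereal (onorm (B \<beta> \<circ> adjoint (A \<alpha>))) \<le> ereal C" unfolding C by (simp add: le_max_iff_disj)
      ultimately show ?thesis by (meson ereal_less_eq(3) mult_right_mono norm_ge_zero order_trans)
    qed
    have C0: "0 \<le> C" unfolding C_def by (intro real_of_ereal_pos) simp
    have h1: "norm h = 1" using hA by (simp add: entropy_domain_def)
    have posA: "0 < norm (A \<alpha> h)" if "\<alpha> \<in> space M" for \<alpha>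
      using hA that by (simp add: entropy_domain_def)
    have posB: "0 < norm (B \<beta> h)" if "\<beta> \<in> space N" for \<beta>
      using hB that by (simp add: entropy_domain_def)
    have log: "integrable M (\<lambda>\<alpha>. ln (norm (A \<alpha> h)) * (norm (A \<alpha> h))\<^sup>2)"
      "integrable N (\<lambda>\<beta>. ln (norm (B \<beta> h)) * (norm (B \<beta> h))\<^sup>2)"
      "0 < C"
      "(\<integral>\<alpha>. ln (norm (A \<alpha> h)) * (norm (A \<alpha> h))\<^sup>2 \<partial>M)
        + (\<integral>\<beta>. ln (norm (B \<beta> h)) * (norm (B \<beta> h))\<^sup>2 \<partial>N) \<le> ln C"
      by (rule log_inequality[OF finM finN A B h1 bound C0 posA posB]; assumption)+
    have "?c = ereal C" using C log(3) by (auto simp: max_def split: if_splits)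
    then have "ereal_ln ?c = ereal (ln C)" using log(3) by (simp add: ereal_ln_def)
    then show ?thesis
      using log(4) by (simp add: shannon_entropy_eq[where A = A and h = h, OF log(1)] shannon_entropy_eq[where A = B and h = h, OF log(2)])
  qed
qed

text \<open>
  For the complex half, every complex frame is a real Parseval frame for the underlying real inner
  product, and its complex adjoints are the real ones.
\<close>

theorem theorem2p4:
  fixes M :: "'o measure" and N :: "'p measure"
  assumes "finite_measure M" and "finite_measure N"
  shows
    "(\<forall>(A :: 'o \<Rightarrow> 'a::{real_inner, complete_space} \<Rightarrow> 'b::{real_inner, complete_space})
       (B :: 'p \<Rightarrow> 'a \<Rightarrow> 'b).
        parseval_frame M A \<longrightarrow> parseval_frame N B \<longrightarrow>
        (\<forall>h \<in> entropy_domain M A \<inter> entropy_domain N B.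
          ereal (ln (measure M (space M) * measure N (space N)))
            \<ge> shannon_entropy M A h + shannon_entropy N B h \<and>
          shannon_entropy M A h + shannon_entropy N B h
            \<ge> - 2 * ereal_ln (SUP (\<alpha>, \<beta>) \<in> space M \<times> space N.
                  ereal (onorm (B \<beta> \<circ> adjoint (A \<alpha>)))))) \<and>
     (\<forall>(A :: 'o \<Rightarrow> 'c::{complex_inner, complete_space} \<Rightarrow> 'd::{complex_inner, complete_space})
       (B :: 'p \<Rightarrow> 'c \<Rightarrow> 'd).
        cparseval_frame M A \<longrightarrow> cparseval_frame N B \<longrightarrow>
        (\<forall>h \<in> entropy_domain M A \<inter> entropy_domain N B.
          ereal (ln (measure M (space M) * measure N (space N)))
            \<ge> shannon_entropy M A h + shannon_entropy N B h \<and>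
          shannon_entropy M A h + shannon_entropy N B h
            \<ge> - 2 * ereal_ln (SUP (\<alpha>, \<beta>) \<in> space M \<times> space N.
                  ereal (onorm (B \<beta> \<circ> cadjoint (A \<alpha>))))))"
proof (intro conjI allI impI ballI)
  fix A :: "'o \<Rightarrow> 'a \<Rightarrow> 'b" and B :: "'p \<Rightarrow> 'a \<Rightarrow> 'b" and h
  assume "parseval_frame M A" "parseval_frame N B"
    and "h \<in> entropy_domain M A \<inter> entropy_domain N B"
  note bounds = parseval_entropy_bounds[OF assms this]
  show "shannon_entropy M A h + shannon_entropy N B h
      \<le> ereal (ln (measure M (space M) * measure N (space N)))"
    and "- 2 * ereal_ln (SUP (\<alpha>, \<beta>) \<in> space M \<times> space N. ereal (onorm (B \<beta> \<circ> adjoint (A \<alpha>))))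
      \<le> shannon_entropy M A h + shannon_entropy N B h"
    by (fact bounds)+
next
  fix A :: "'o \<Rightarrow> 'c \<Rightarrow> 'd" and B :: "'p \<Rightarrow> 'c \<Rightarrow> 'd" and h
  assume A: "cparseval_frame M A" and B: "cparseval_frame N B"
    and h: "h \<in> entropy_domain M A \<inter> entropy_domain N B"
  note bounds = parseval_entropy_bounds[OF assms
      cparseval_frame_imp_parseval_frame[OF A] cparseval_frame_imp_parseval_frame[OF B] h]
  show "shannon_entropy M A h + shannon_entropy N B h
      \<le> ereal (ln (measure M (space M) * measure N (space N)))"
    by (fact bounds(1))
  have "(SUP (\<alpha>, \<beta>) \<in> space M \<times> space N. ereal (onorm (B \<beta> \<circ> cadjoint (A \<alpha>))))
     = (SUP (\<alpha>, \<beta>) \<in> space M \<times> space N. ereal (onorm (B \<beta> \<circ> adjoint (A \<alpha>))))"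
    using A by (intro SUP_cong refl) (auto simp: cparseval_frame_def cadjoint_eq_adjoint)
  then show "- 2 * ereal_ln (SUP (\<alpha>, \<beta>) \<in> space M \<times> space N. ereal (onorm (B \<beta> \<circ> cadjoint (A \<alpha>))))
      \<le> shannon_entropy M A h + shannon_entropy N B h"
    using bounds(2) by simp
qed

end
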